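(* Let $n\ge0$ and let $x_i=F_0^{i-1}(q_1)$ for $1\le i\le2n+2$ and $x_i=F_0^{i-2n-3}(q_2)$ for $2n+3\le i\le3n+3$. Let $I_n^n(f):=\sum_{i=1}^{3n+3}\omega_if(x_i)$ be a quadrature rule which integrates functions in $\mathcal H_n$ exactly, i.e. $I_n^n(h)=\int_{SG}h\,d\mu$ for all $h\in\mathcal H_n$. For $m\ge n$ let $$I_n^m(f):=3^{-(m-n)}\sum_{|w|=m-n}I_n^n(f\circ F_w).$$ Then there is a constant $c_1(n)$, independent of $f$ and $m$, such that for all $m\ge n$ and all $f$ for which $\Delta f,\dots,\Delta^{n+1}f$ exist and are continuous, $$\left|I_n^m(f)-\int_{SG}f\,d\mu\right|\le c_1(n)\,5^{-(n+1)m}\,\|\Delta^{n+1}f\|_\infty.$$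
   Context: Sierpinski gasket: let $q_0=(\tfrac12,\tfrac{\sqrt3}{2})$, $q_1=(0,0)$, $q_2=(1,0)$, $V_0=\{q_0,q_1,q_2\}$, $F_i(x)=\tfrac12(x-q_i)+q_i$, and let $SG\subset\mathbb R^2$ be the unique nonempty compact set with $SG=\bigcup_{i=0}^2F_i(SG)$. For a word $w=(w_1,\dots,w_r)\in\{0,1,2\}^r$, $|w|=r$, put $F_w=F_{w_1}\circ\cdots\circ F_{w_r}$ (identity for the empty word); $F_w(SG)$ is called an $r$-cell; $V_r=\bigcup_{|w|=r}F_w(V_0)$; distinct $x,y\in V_r$ satisfy $x\sim_r y$ if they lie in a common $r$-cell. $\mu$ is the self-similar Borel probability measure with $\mu(F_w(SG))=3^{-|w|}$. All functions are real-valued. Energy and Laplacian: $\mathscr E(u,v)=\lim_{r\to\infty}(3/5)^{-r}\sum_{x\sim_r y}(u(x)-u(y))(v(x)-v(y))$ (sum over unordered pairs), and $u\in\operatorname{dom}\mathscr E$ if $\mathscr E(u,u)$ exists and is finite. For $u\in\operatorname{dom}\mathscr E$ and $f$ continuous, $\Delta u=f$ means $\mathscr E(u,v)=-\int_{SG}fv\,d\mu$ for all $v\in\operatorname{dom}\mathscr E$ vanishing on $V_0$. $\mathcal H_n=\{u:\Delta^{n+1}u=0\}$, a vector space of dimension $3n+3$. $\|\cdot\|_\infty$ is the sup norm on $SG$. *)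

theory Defs
  imports "HOL-Probability.Probability"
begin

definition sg_q :: "nat \<Rightarrow> real^2" where
  "sg_q i = (if i = 0 then vector [1/2, sqrt 3 / 2]
             else if i = 1 then vector [0, 0]
             else vector [1, 0])"

definition sg_F :: "nat \<Rightarrow> real^2 \<Rightarrow> real^2" where
  "sg_F i x = (1/2) *\<^sub>R (x - sg_q i) + sg_q i"

definition SG :: "(real^2) set" where
  "SG = (THE K. compact K \<and> K \<noteq> {} \<and> K = (\<Union>i<3. sg_F i ` K))"

definition sg_words :: "nat \<Rightarrow> nat list set" where
  "sg_words r = {w. length w = r \<and> set w \<subseteq> {..<3}}"

primrec sg_Fw :: "nat list \<Rightarrow> real^2 \<Rightarrow> real^2" where
  "sg_Fw [] = id"
| "sg_Fw (i # w) = sg_F i \<circ> sg_Fw w"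

definition sg_V :: "nat \<Rightarrow> (real^2) set" where
  "sg_V r = (\<Union>w\<in>sg_words r. sg_Fw w ` (sg_q ` {..<3}))"

definition sg_adj :: "nat \<Rightarrow> real^2 \<Rightarrow> real^2 \<Rightarrow> bool" where
  "sg_adj r x y \<longleftrightarrow> x \<in> sg_V r \<and> y \<in> sg_V r \<and> x \<noteq> y \<and>
     (\<exists>w\<in>sg_words r. x \<in> sg_Fw w ` SG \<and> y \<in> sg_Fw w ` SG)"

text \<open>The self-similar measure is a Borel measure on the plane; the clause for the
  empty word says that it is carried by \<open>SG\<close>. These properties determine it uniquely.\<close>

definition is_sg_measure :: "(real^2) measure \<Rightarrow> bool" where
  "is_sg_measure \<mu> \<longleftrightarrow>
     sets \<mu> = sets borel \<and> prob_space \<mu> \<and>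
     (\<forall>A\<in>sets borel. measure \<mu> A = (\<Sum>i<3. (1/3) * measure \<mu> (sg_F i -` A))) \<and>
     (\<forall>r. \<forall>w\<in>sg_words r. measure \<mu> (sg_Fw w ` SG) = (1/3) ^ r)"

text \<open>Functions on \<open>SG\<close> are represented by functions on the plane, of which only the
  values on \<open>SG\<close> are ever used.\<close>

text \<open>The factor 1/2 turns the sum over ordered pairs into one over unordered pairs.\<close>

definition sg_energy_level :: "nat \<Rightarrow> (real^2 \<Rightarrow> real) \<Rightarrow> (real^2 \<Rightarrow> real) \<Rightarrow> real" where
  "sg_energy_level r u v = (5/3) ^ r *
     ((1/2) * (\<Sum>(x, y)\<in>{(x, y). sg_adj r x y}. (u x - u y) * (v x - v y)))"

definition sg_energy :: "(real^2 \<Rightarrow> real) \<Rightarrow> (real^2 \<Rightarrow> real) \<Rightarrow> real" where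
  "sg_energy u v = lim (\<lambda>r. sg_energy_level r u v)"

text \<open>The energy only sees the values on the vertices; elements of its domain are
  continuous functions on \<open>SG\<close>, so that those values determine them.\<close>

definition sg_dom_energy :: "(real^2 \<Rightarrow> real) set" where
  "sg_dom_energy =
     {u. continuous_on SG u \<and> convergent (\<lambda>r. sg_energy_level r u u)}"

definition sg_laplacian ::
    "(real^2) measure \<Rightarrow> (real^2 \<Rightarrow> real) \<Rightarrow> (real^2 \<Rightarrow> real) \<Rightarrow> bool" where
  "sg_laplacian \<mu> u f \<longleftrightarrow> u \<in> sg_dom_energy \<and> continuous_on SG f \<and>
     (\<forall>v\<in>sg_dom_energy. (\<forall>x\<in>sg_V 0. v x = 0) \<longrightarrow>
        sg_energy u v = - (LINT x:SG|\<mu>. f x * v x))"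

text \<open>\<open>sg_laplacian_pow \<mu> k u f\<close> says that all of \<open>\<Delta>u, \<dots>, \<Delta>\<^sup>ku\<close> exist and are
  continuous, and that \<open>\<Delta>\<^sup>ku = f\<close> on \<open>SG\<close>.\<close>

primrec sg_laplacian_pow ::
    "(real^2) measure \<Rightarrow> nat \<Rightarrow> (real^2 \<Rightarrow> real) \<Rightarrow> (real^2 \<Rightarrow> real) \<Rightarrow> bool" where
  "sg_laplacian_pow \<mu> 0 u f \<longleftrightarrow> (\<forall>x\<in>SG. u x = f x)"
| "sg_laplacian_pow \<mu> (Suc k) u f \<longleftrightarrow>
     (\<exists>g. sg_laplacian \<mu> u g \<and> sg_laplacian_pow \<mu> k g f)"

definition sg_H :: "(real^2) measure \<Rightarrow> nat \<Rightarrow> (real^2 \<Rightarrow> real) set" where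
  "sg_H \<mu> n = {u. sg_laplacian_pow \<mu> (n + 1) u (\<lambda>_. 0)}"

definition sg_sup_norm :: "(real^2 \<Rightarrow> real) \<Rightarrow> real" where
  "sg_sup_norm f = (SUP x\<in>SG. \<bar>f x\<bar>)"

definition sg_node :: "nat \<Rightarrow> nat \<Rightarrow> real^2" where
  "sg_node n i = (if i \<le> 2 * n + 2 then (sg_F 0 ^^ (i - 1)) (sg_q 1)
                  else (sg_F 0 ^^ (i - (2 * n + 3))) (sg_q 2))"

definition sg_quad :: "(nat \<Rightarrow> real) \<Rightarrow> nat \<Rightarrow> (real^2 \<Rightarrow> real) \<Rightarrow> real" where
  "sg_quad \<omega> n f = (\<Sum>i = 1..3 * n + 3. \<omega> i * f (sg_node n i))"

definition sg_composite_quad ::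
    "(nat \<Rightarrow> real) \<Rightarrow> nat \<Rightarrow> nat \<Rightarrow> (real^2 \<Rightarrow> real) \<Rightarrow> real" where
  "sg_composite_quad \<omega> n m f =
     (1/3) ^ (m - n) * (\<Sum>w\<in>sg_words (m - n). sg_quad \<omega> n (f \<circ> sg_Fw w))"

end

theory Submission
  imports Defs
begin

text \<open>If \<open>\<Delta>\<^sup>n\<^sup>+\<^sup>1u = g\<close>, subtract from \<open>u\<close> the solution \<open>p\<close> of
  \<open>\<Delta>\<^sup>n\<^sup>+\<^sup>1p = g\<close> for which all of \<open>p, \<Delta>p, \<dots>, \<Delta>\<^sup>np\<close> vanish on \<open>V\<^sub>0\<close>. The difference lies in
  \<open>\<H>\<^sub>n\<close>, so the quadrature error of \<open>u\<close> is that of \<open>p\<close>, which is at most a constant times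
  \<open>\<parallel>p\<parallel>\<close> and hence at most a constant times \<open>\<parallel>g\<parallel>\<close>. On an \<open>r\<close>-cell the Laplacian scales by \<open>5\<^sup>-\<^sup>r\<close>,
  because energy scales by \<open>(5/3)\<^sup>r\<close> and measure by \<open>3\<^sup>-\<^sup>r\<close>; averaging the local estimates over
  the cells with \<open>r = m - n\<close> gives the rate \<open>5\<^sup>-\<^sup>(\<^sup>n\<^sup>+\<^sup>1\<^sup>)\<^sup>m\<close>.\<close>

subsection \<open>The gasket and its cells\<close>

text \<open>The one analytic estimate is that energy dominates the sup norm of functions vanishing
  at the corners. Passing to a subcell multiplies the energy by at most 3/5, so the oscillations
  along a chain of nested cells form a geometric series of ratio sqrt(3/5). The estimate makes
  minimising sequences converge uniformly, which gives existence for the Poisson equation, and it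
  also bounds the solution. The obstacle is that the objects are given indirectly: the gasket by a
  definite description, the energy as a limit of sums over adjacent vertices. The gasket has to be
  identified with the closure of its vertices, and the energy rewritten as a sum over words, which
  rests on distinct cells meeting only in corners. The same fact allows a test function on one cell,
  zero at its corners, to be continued by zero, and this makes the weak Laplacian a local
  notion.\<close>

lemma less_3_cases: "i < 3 \<longleftrightarrow> i = 0 \<or> i = 1 \<or> i = (2::nat)"
  by auto

lemma lessThan_3: "{..<3} = {0, 1, 2::nat}"
  by auto

text \<open>Barycentric coordinates with respect to the three corners. In them \<open>sg_F i\<close>
  just halves and adds 1/2 to coordinate \<open>i\<close>, so questions about cells become linear
  inequalities free of \<open>sqrt 3\<close>.\<close>

definition sg_bary :: "nat \<Rightarrow> real^2 \<Rightarrow> real" where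
  "sg_bary i x = (if i = 0 then 2 / sqrt 3 * x $ 2
                  else if i = 1 then 1 - x $ 1 - x $ 2 / sqrt 3
                  else x $ 1 - x $ 2 / sqrt 3)"

lemma sg_bary_q: "i < 3 \<Longrightarrow> j < 3 \<Longrightarrow> sg_bary j (sg_q i) = (if i = j then 1 else 0)"
  by (auto simp: less_3_cases sg_bary_def sg_q_def)

lemma sg_bary_F:
  "i < 3 \<Longrightarrow> j < 3 \<Longrightarrow> sg_bary j (sg_F i x) = (sg_bary j x + (if i = j then 1 else 0)) / 2"
  by (auto simp: less_3_cases sg_bary_def sg_q_def sg_F_def field_simps)

lemma sg_bary_sum: "(\<Sum>j<3. sg_bary j x) = 1"
  by (simp add: lessThan_3 sg_bary_def field_simps)

lemma sg_bary_eqI: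
  assumes "\<And>j. j < 3 \<Longrightarrow> sg_bary j x = sg_bary j y"
  shows "x = y"
proof -
  have "x $ 2 = y $ 2" "x $ 1 = y $ 1"
    using assms[of 0] assms[of 2] by (auto simp: sg_bary_def)
  then show ?thesis
    by (simp add: vec_eq_iff forall_2)
qed

lemma continuous_sg_bary: "continuous_on A (sg_bary j)"
  by (cases "j = 0"; cases "j = 1") (auto simp: sg_bary_def[abs_def] intro!: continuous_intros)

lemma sg_F_q [simp]: "sg_F i (sg_q i) = sg_q i"
  by (simp add: sg_F_def)

lemma sg_F_q_commute: "sg_F i (sg_q j) = sg_F j (sg_q i)"
  by (simp add: sg_F_def vec_eq_iff field_simps)

lemma sg_q_inj: "i < 3 \<Longrightarrow> j < 3 \<Longrightarrow> sg_q i = sg_q j \<longleftrightarrow> i = j"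
  using sg_bary_q[of i i] sg_bary_q[of j i] by (auto split: if_splits)

lemma inj_sg_F: "inj (sg_F i)"
  by (auto simp: inj_on_def sg_F_def)

lemma sg_F_eq_iff [simp]: "sg_F i x = sg_F i y \<longleftrightarrow> x = y"
  using inj_sg_F by (auto simp: inj_on_def)

lemma continuous_sg_F [continuous_intros]:
  "continuous_on A f \<Longrightarrow> continuous_on A (\<lambda>x. sg_F i (f x))"
  unfolding sg_F_def by (intro continuous_intros)

lemma dist_sg_F: "dist (sg_F i x) (sg_F i y) = dist x y / 2"
proof -
  have "sg_F i x - sg_F i y = (1/2) *\<^sub>R (x - y)"
    by (simp add: sg_F_def algebra_simps)
  then show ?thesis
    by (simp add: dist_norm)
qed

lemma dist_sg_Fw: "dist (sg_Fw w x) (sg_Fw w y) = dist x y / 2 ^ length w"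
  by (induction w) (auto simp: dist_sg_F)

section \<open>Words and the vertices of all levels\<close>

lemma sg_words_0 [simp]: "sg_words 0 = {[]}"
  by (auto simp: sg_words_def)

lemma sg_words_Suc: "sg_words (Suc r) = (\<lambda>(i, w). i # w) ` ({..<3} \<times> sg_words r)"
  by (auto simp: sg_words_def image_iff length_Suc_conv)

lemma finite_sg_words [simp]: "finite (sg_words r)"
  by (induction r) (auto simp: sg_words_Suc)

lemma card_sg_words: "card (sg_words r) = 3 ^ r"
proof (induction r)
  case (Suc r)
  have "inj_on (\<lambda>(i, w). i # w) ({..<3} \<times> sg_words r)"
    by (auto simp: inj_on_def)
  then show ?case
    unfolding sg_words_Suc by (subst card_image) (auto simp: Suc card_cartesian_product)
qed simp

lemma sum_sg_words_Suc:
  "(\<Sum>w\<in>sg_words (Suc r). f w) = (\<Sum>i<3. \<Sum>w\<in>sg_words r. f (i # w))"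
proof -
  have "inj_on (\<lambda>(i, w). i # w) ({..<3} \<times> sg_words r)"
    by (auto simp: inj_on_def)
  then show ?thesis
    unfolding sg_words_Suc
    by (subst sum.reindex) (auto simp: sum.cartesian_product case_prod_unfold)
qed

lemma sg_V_0: "sg_V 0 = sg_q ` {..<3}"
  by (simp add: sg_V_def)

lemma sg_cells_Suc:
  "(\<Union>w\<in>sg_words (Suc r). sg_Fw w ` K) = (\<Union>i<3. sg_F i ` (\<Union>w\<in>sg_words r. sg_Fw w ` K))"
  proof -
  have "(\<Union>w\<in>sg_words (Suc r). sg_Fw w ` K) = (\<Union>i<3. \<Union>w\<in>sg_words r. sg_Fw (i # w) ` K)"
    by (fastforce simp: sg_words_Suc)
  then show ?thesis
    by (simp add: image_UN image_comp)
qed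

lemma sg_V_Suc: "sg_V (Suc r) = (\<Union>i<3. sg_F i ` sg_V r)"
  unfolding sg_V_def sg_cells_Suc ..

lemma sg_q_in_V: "i < 3 \<Longrightarrow> sg_q i \<in> sg_V r"
proof (induction r)
  case (Suc r)
  then show ?case
    using sg_F_q[of i] unfolding sg_V_Suc by force
qed (auto simp: sg_V_0)

text \<open>Usually written \<open>V_*\<close>; its closure is the concrete model of the
  attractor.\<close>

definition sg_Vs :: "(real^2) set" where
  "sg_Vs = (\<Union>r. sg_V r)"

lemma sg_Vs_eq: "sg_Vs = (\<Union>i<3. sg_F i ` sg_Vs)"
proof (intro equalityI subsetI)
  fix x assume "x \<in> sg_Vs"
  then obtain r where r: "x \<in> sg_V r"
    by (auto simp: sg_Vs_def)
  show "x \<in> (\<Union>i<3. sg_F i ` sg_Vs)"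
  proof (cases r)
    \<comment> \<open>There is no lower level to pull back to, but a corner is the fixed point of
      its own map.\<close>
    case 0
    then obtain i where i: "i < 3" "x = sg_F i (sg_q i)"
      using r by (auto simp: sg_V_0)
    then have "sg_q i \<in> sg_Vs"
      using sg_q_in_V[of i 0] by (auto simp: sg_Vs_def)
    then show ?thesis
      using i by blast
  next
    case (Suc k)
    then show ?thesis
      using r by (auto simp: sg_V_Suc sg_Vs_def)
  qed
next
  fix x assume "x \<in> (\<Union>i<3. sg_F i ` sg_Vs)"
  then obtain i y r where "i < 3" "x = sg_F i y" "y \<in> sg_V r"
    by (auto simp: sg_Vs_def)
  then have "x \<in> sg_V (Suc r)"
    by (auto simp: sg_V_Suc)
  then show "x \<in> sg_Vs"
    by (auto simp: sg_Vs_def)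
qed

lemma sg_V_bary_nonneg: "x \<in> sg_V r \<Longrightarrow> j < 3 \<Longrightarrow> 0 \<le> sg_bary j x"
  by (induction r arbitrary: x) (auto simp: sg_V_0 sg_V_Suc sg_bary_q sg_bary_F)

lemma bounded_sg_Vs: "bounded sg_Vs"
proof -
  have "norm x \<le> \<bar>1\<bar> + \<bar>sqrt 3\<bar>" if "x \<in> sg_Vs" for x
  proof -
    from that obtain r where r: "x \<in> sg_V r"
      by (auto simp: sg_Vs_def)
    have b: "0 \<le> sg_bary 0 x" "0 \<le> sg_bary 1 x" "0 \<le> sg_bary 2 x"
      using sg_V_bary_nonneg[OF r] by auto
    have s: "sqrt 3 > 0" by simp
    have "0 \<le> x $ 2"
      using b(1) by (simp add: sg_bary_def zero_le_divide_iff zero_le_mult_iff)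
    moreover from this have "0 \<le> x $ 2 / sqrt 3" by simp
    moreover have "0 \<le> 1 - x $ 1 - x $ 2 / sqrt 3" "0 \<le> x $ 1 - x $ 2 / sqrt 3"
      using b by (auto simp: sg_bary_def)
    ultimately have "\<bar>x $ 1\<bar> \<le> 1" "x $ 2 / sqrt 3 \<le> 1"
      by linarith+
    with \<open>0 \<le> x $ 2\<close> have "\<bar>x $ 1\<bar> \<le> 1" "\<bar>x $ 2\<bar> \<le> sqrt 3"
      by (auto simp: field_simps)
    then show ?thesis
      using norm_le_l1_cart[of x] by (simp add: sum_2)
  qed
  then show ?thesis
    by (rule boundedI)
qed

section \<open>Existence and uniqueness of the attractor\<close>

lemma closure_image_sg_F: "sg_F i ` closure A = closure (sg_F i ` A)"
proof -
  have e: "sg_F i = (\<lambda>x. (1/2) *\<^sub>R sg_q i + x) \<circ> (\<lambda>x. (1/2) *\<^sub>R x)"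
    by (auto simp: sg_F_def fun_eq_iff algebra_simps vec_eq_iff)
  show ?thesis
    unfolding e image_comp[symmetric] by (simp add: closure_translation closure_scaleR)
qed

lemma attractor_Fw_subset:
  assumes "K = (\<Union>i<3. sg_F i ` K)" "w \<in> sg_words r"
  shows "sg_Fw w ` K \<subseteq> K"
  using assms(2)
proof (induction r arbitrary: w)
  case (Suc r)
  then obtain i v where w: "w = i # v" "i < 3" "v \<in> sg_words r"
    by (auto simp: sg_words_Suc)
  then have "sg_Fw v ` K \<subseteq> K" using Suc by blast
  then have "sg_Fw w ` K \<subseteq> sg_F i ` K" using w by auto
  also have "\<dots> \<subseteq> K" using assms(1) w by blast
  finally show ?case .
qed simp

lemma attractor_cover:
  assumes "K = (\<Union>i<3. sg_F i ` K)"
  shows "K = (\<Union>w\<in>sg_words r. sg_Fw w ` K)"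
proof (induction r)
  case (Suc r)
  show ?case
    unfolding sg_cells_Suc Suc[symmetric] by (rule assms)
qed simp

text \<open>Iterating \<open>sg_F i\<close> from any point of \<open>K\<close> converges to
  \<open>sg_q i\<close>, so \<open>K\<close> contains the corners and with them all vertices.
  Conversely, \<open>K\<close> is covered by cells whose diameter shrinks like \<open>2^-r\<close>,
  and each point of such a cell is that close to the vertex \<open>sg_Fw w (sg_q 0)\<close>.\<close>

lemma attractor_unique:
  assumes "compact K" "K \<noteq> {}" and K: "K = (\<Union>i<3. sg_F i ` K)"
  shows "K = closure sg_Vs"
proof
  have q: "sg_q i \<in> K" if "i < 3" for i
  proof -
    from \<open>K \<noteq> {}\<close> obtain x where x: "x \<in> K" by blast
    have *: "(sg_F i ^^ n) x \<in> K" for n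
    proof (induction n)
      case (Suc n)
      then have "(sg_F i ^^ Suc n) x \<in> (\<Union>i<3. sg_F i ` K)"
        using that by (simp del: UN_iff) blast
      then show ?case
        by (rule subsetD[OF equalityD2[OF K]])
    qed (simp add: x)
    have "dist ((sg_F i ^^ n) x) (sg_q i) = dist x (sg_q i) * (1/2) ^ n" for n
    proof (induction n)
      case (Suc n)
      then show ?case
        using dist_sg_F[of i "(sg_F i ^^ n) x" "sg_q i"] by simp
    qed simp
    moreover have "(\<lambda>n. dist x (sg_q i) * (1/2) ^ n) \<longlonglongrightarrow> dist x (sg_q i) * 0"
      by (intro tendsto_intros LIMSEQ_realpow_zero) auto
    ultimately have "(\<lambda>n. (sg_F i ^^ n) x) \<longlonglongrightarrow> sg_q i"
      by (subst tendsto_dist_iff) simp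
    with * show ?thesis
      by (rule closed_sequentially[OF compact_imp_closed[OF \<open>compact K\<close>]])
  qed
  have "sg_V r \<subseteq> K" for r
  proof
    fix x assume "x \<in> sg_V r"
    then obtain w i where "w \<in> sg_words r" "i < 3" "x = sg_Fw w (sg_q i)"
      by (auto simp: sg_V_def)
    then show "x \<in> K"
      using attractor_Fw_subset[OF K, of w r] q[of i] by blast
  qed
  then show "closure sg_Vs \<subseteq> K"
    using \<open>compact K\<close> by (intro closure_minimal) (auto simp: sg_Vs_def compact_imp_closed)
  show "K \<subseteq> closure sg_Vs"
  proof
    fix x assume "x \<in> K"
    obtain B where B: "\<And>y. y \<in> K \<Longrightarrow> dist y (sg_q 0) \<le> B"
      using compact_imp_bounded[OF \<open>compact K\<close>] by (metis bounded_any_center dist_commute)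
    show "x \<in> closure sg_Vs"
      unfolding closure_approachable
    proof (intro allI impI)
      fix e :: real assume "e > 0"
      have "(\<lambda>r. B * (1/2) ^ r) \<longlonglongrightarrow> B * 0"
        by (intro tendsto_intros LIMSEQ_realpow_zero) auto
      then have "\<forall>\<^sub>F r in sequentially. B * (1/2) ^ r < e"
        using \<open>e > 0\<close> by (simp add: order_tendsto_iff)
      then obtain r where r: "B * (1/2) ^ r < e"
        by (metis eventually_sequentially order_refl)
      obtain w y where w: "w \<in> sg_words r" "y \<in> K" "x = sg_Fw w y"
        using \<open>x \<in> K\<close> attractor_cover[OF K, of r] by blast
      have "dist (sg_Fw w (sg_q 0)) x = dist y (sg_q 0) * (1/2) ^ r"
        using w by (simp add: dist_sg_Fw dist_commute sg_words_def power_divide)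
      also have "\<dots> \<le> B * (1/2) ^ r"
        using B[OF w(2)] by (intro mult_right_mono) auto
      finally have "dist (sg_Fw w (sg_q 0)) x < e"
        using r by simp
      moreover have "sg_Fw w (sg_q 0) \<in> sg_Vs"
        using w unfolding sg_Vs_def sg_V_def by (intro UN_I[of r] UN_I[of w] imageI) auto
      ultimately show "\<exists>y\<in>sg_Vs. dist y x < e"
        by blast
    qed
  qed
qed

text \<open>\<open>SG\<close> is a definite description, so nothing can be said of it before an
  attractor is exhibited and shown unique. The closure of the vertices is one because the affine
  maps commute with closure.\<close>

lemma SG_eq_closure: "SG = closure sg_Vs"
  and SG_attractor: "compact SG \<and> SG \<noteq> {} \<and> SG = (\<Union>i<3. sg_F i ` SG)"
proof -
  have 1: "closure sg_Vs = (\<Union>i<3. sg_F i ` closure sg_Vs)"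
    unfolding closure_image_sg_F
    by (subst sg_Vs_eq) (simp add: lessThan_3)
  have "sg_Vs \<noteq> {}"
    using sg_q_in_V[of 0] by (auto simp: sg_Vs_def)
  then have 2: "compact (closure sg_Vs) \<and> closure sg_Vs \<noteq> {} \<and>
      closure sg_Vs = (\<Union>i<3. sg_F i ` closure sg_Vs)"
    by (intro conjI 1) (use bounded_sg_Vs in \<open>simp_all add: compact_closure\<close>)
  show "SG = closure sg_Vs"
    unfolding SG_def
    by (rule the_equality, rule 2, elim conjE, rule attractor_unique)
  show "compact SG \<and> SG \<noteq> {} \<and> SG = (\<Union>i<3. sg_F i ` SG)"
    unfolding \<open>SG = closure sg_Vs\<close> by (rule 2)
qed

lemma compact_SG: "compact SG" and SG_eq: "SG = (\<Union>i<3. sg_F i ` SG)"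
  by (rule conjunct1[OF SG_attractor], rule conjunct2[OF conjunct2[OF SG_attractor]])

lemma sg_F_in_SG: "i < 3 \<Longrightarrow> x \<in> SG \<Longrightarrow> sg_F i x \<in> SG"
  using SG_eq by blast

lemma sg_Fw_in_SG: "w \<in> sg_words r \<Longrightarrow> x \<in> SG \<Longrightarrow> sg_Fw w x \<in> SG"
  using attractor_Fw_subset[OF SG_eq] by blast

lemma sg_V_subset_SG: "sg_V r \<subseteq> SG"
  using closure_subset[of sg_Vs] unfolding SG_eq_closure by (auto simp: sg_Vs_def)

lemma sg_q_in_SG: "i < 3 \<Longrightarrow> sg_q i \<in> SG"
  using sg_q_in_V sg_V_subset_SG by blast

section \<open>Intersections of cells\<close>

lemma SG_bary_nonneg:
  assumes "x \<in> SG" "j < 3"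
  shows "0 \<le> sg_bary j x"
proof -
  have "closed {x. 0 \<le> sg_bary j x}"
    by (intro closed_Collect_le continuous_intros continuous_sg_bary)
  moreover have "sg_Vs \<subseteq> {x. 0 \<le> sg_bary j x}"
    using sg_V_bary_nonneg assms(2) by (auto simp: sg_Vs_def)
  ultimately show ?thesis
    using assms(1) closure_minimal unfolding SG_eq_closure by blast
qed

text \<open>Comparing coordinate \<open>j\<close> of the common point from both sides shows that
  coordinate \<open>j\<close> of \<open>x\<close> exceeds that of \<open>y\<close> by 1. Since
  coordinates on the gasket are nonnegative and sum to 1, \<open>x\<close> must be the corner
  \<open>sg_q j\<close>; the claim on \<open>y\<close> is symmetric.\<close>

lemma sg_cells_inter:
  assumes "i < 3" "j < 3" "i \<noteq> j" "x \<in> SG" "y \<in> SG" "sg_F i x = sg_F j y"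
  shows "x = sg_q j \<and> y = sg_q i"
proof
  have *: "x = sg_q j" if ij: "i < 3" "j < 3" "i \<noteq> j" and xy: "x \<in> SG" "y \<in> SG" "sg_F i x = sg_F j y" for i j x y
  proof (rule sg_bary_eqI)
    have "sg_bary j (sg_F i x) = sg_bary j (sg_F j y)"
      using xy by simp
    then have a: "sg_bary j x \<ge> 1"
      using SG_bary_nonneg[OF xy(2) ij(2)] ij by (simp add: sg_bary_F)
    fix k :: nat assume "k < 3"
    moreover have "sg_bary 0 x + sg_bary 1 x + sg_bary 2 x = 1"
      using sg_bary_sum[of x] by (simp add: lessThan_3)
    ultimately show "sg_bary k x = sg_bary k (sg_q j)"
      using a ij SG_bary_nonneg[OF xy(1), of 0] SG_bary_nonneg[OF xy(1), of 1]
        SG_bary_nonneg[OF xy(1), of 2]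
      by (auto simp: sg_bary_q less_3_cases)
  qed
  show "x = sg_q j" using *[OF assms] .
  show "y = sg_q i" using *[of j i y x] assms by simp
qed

text \<open>Adjacency speaks of arbitrary points of \<open>sg_V r\<close> in a common cell; this
  reduces them to corners of that cell. A vertex reached through a different first letter is a
  junction point, hence again a corner.\<close>

lemma sg_V_cell:
  "w \<in> sg_words r \<Longrightarrow> x \<in> SG \<Longrightarrow> sg_Fw w x \<in> sg_V r \<Longrightarrow> x \<in> sg_V 0"
proof (induction r arbitrary: w x)
  case (Suc r)
  then obtain a v where w: "w = a # v" "a < 3" "v \<in> sg_words r"
    by (auto simp: sg_words_Suc)
  from Suc.prems(3) obtain b y where b: "b < 3" "y \<in> sg_V r" "sg_Fw w x = sg_F b y"
    by (auto simp: sg_V_Suc)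
  have v: "sg_Fw v x \<in> SG"
    using w Suc.prems sg_Fw_in_SG by blast
  have "sg_Fw v x \<in> sg_V r"
  proof (cases "a = b")
    case True
    then show ?thesis using b w by simp
  next
    case False
    then have "sg_Fw v x = sg_q b"
      using sg_cells_inter[of a b "sg_Fw v x" y] b w v sg_V_subset_SG by auto
    then show ?thesis using b sg_q_in_V by simp
  qed
  then show ?case
    using Suc w by blast
qed simp

text \<open>Two cells may share a vertex but never an edge. This is the injectivity that lets the
  sum over adjacent pairs be reindexed by cells.\<close>

lemma sg_cell_edge_unique:
  "\<lbrakk>v \<in> sg_words r; w \<in> sg_words r; i < 3; j < 3; k < 3; l < 3; i \<noteq> j;
    sg_Fw v (sg_q i) = sg_Fw w (sg_q k); sg_Fw v (sg_q j) = sg_Fw w (sg_q l)\<rbrakk>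
   \<Longrightarrow> v = w \<and> i = k \<and> j = l"
proof (induction r arbitrary: v w)
  case 0
  then show ?case by (simp add: sg_q_inj)
next
  case (Suc r)
  then obtain a v' b w' where vw: "v = a # v'" "a < 3" "v' \<in> sg_words r"
      "w = b # w'" "b < 3" "w' \<in> sg_words r"
    by (auto simp: sg_words_Suc)
  have in_SG: "sg_Fw v' (sg_q i) \<in> SG" "sg_Fw v' (sg_q j) \<in> SG"
      "sg_Fw w' (sg_q k) \<in> SG" "sg_Fw w' (sg_q l) \<in> SG"
    using vw Suc.prems by (auto intro!: sg_Fw_in_SG sg_q_in_SG)
  have "a = b"
  proof (rule ccontr)
    \<comment> \<open>Both endpoints would be the single point in which the cells \<open>a\<close>
      and \<open>b\<close> meet, although distinct corners have distinct images.\<close>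
    assume "a \<noteq> b"
    then have "sg_Fw v' (sg_q i) = sg_Fw v' (sg_q j)"
      using sg_cells_inter[OF vw(2,5) _ in_SG(1,3)] sg_cells_inter[OF vw(2,5) _ in_SG(2,4)]
        Suc.prems vw by simp
    then have "dist (sg_q i) (sg_q j) = 0"
      using dist_sg_Fw[of v' "sg_q i" "sg_q j"] by simp
    then show False
      using Suc.prems sg_q_inj by simp
  qed
  then have "sg_Fw v' (sg_q i) = sg_Fw w' (sg_q k)" "sg_Fw v' (sg_q j) = sg_Fw w' (sg_q l)"
    using Suc.prems(8,9) by (simp_all add: vw)
  then have "v' = w' \<and> i = k \<and> j = l"
    by (rule Suc.IH[OF vw(3,6) Suc.prems(3-7)])
  then show ?case
    using \<open>a = b\<close> by (simp add: vw)
qed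

subsection \<open>Graph energies\<close>

text \<open>The energy of a single triangle, from which every level is assembled. Diagonal terms
  vanish and 1/2 undoes the ordering of pairs.\<close>

definition sg_Q :: "(real^2 \<Rightarrow> real) \<Rightarrow> (real^2 \<Rightarrow> real) \<Rightarrow> real" where
  "sg_Q u v = 1/2 * (\<Sum>i<3. \<Sum>j<3. (u (sg_q i) - u (sg_q j)) * (v (sg_q i) - v (sg_q j)))"

lemma sg_adj_pairs:
  "{(x, y). sg_adj r x y} =
   (\<lambda>(w, i, j). (sg_Fw w (sg_q i), sg_Fw w (sg_q j))) `
     (sg_words r \<times> {(i, j). i < 3 \<and> j < 3 \<and> i \<noteq> j})"
  (is "?L = ?R")
proof (intro equalityI subsetI)
  fix p assume "p \<in> ?L"
  then obtain x y w where xy: "p = (sg_Fw w x, sg_Fw w y)" "w \<in> sg_words r" "x \<in> SG" "y \<in> SG"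
      "sg_Fw w x \<in> sg_V r" "sg_Fw w y \<in> sg_V r" "x \<noteq> y"
    by (auto simp: sg_adj_def)
  then obtain i j where "i < 3" "j < 3" "x = sg_q i" "y = sg_q j"
    using sg_V_cell[of w r x] sg_V_cell[of w r y] by (auto simp: sg_V_0)
  then show "p \<in> ?R"
    using xy by (auto intro!: image_eqI[of _ _ "(w, i, j)"])
next
  fix p assume "p \<in> ?R"
  then obtain w i j where p: "p = (sg_Fw w (sg_q i), sg_Fw w (sg_q j))" "w \<in> sg_words r"
      "i < 3" "j < 3" "i \<noteq> j"
    by auto
  have "dist (sg_q i) (sg_q j) \<noteq> 0"
    using p sg_q_inj by simp
  then have "sg_Fw w (sg_q i) \<noteq> sg_Fw w (sg_q j)"
    using dist_sg_Fw[of w "sg_q i" "sg_q j"] by fastforce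
  moreover have "sg_Fw w (sg_q i) \<in> sg_V r" "sg_Fw w (sg_q j) \<in> sg_V r"
    using p unfolding sg_V_def by auto
  ultimately show "p \<in> ?L"
    using p sg_q_in_SG by (auto simp: sg_adj_def)
qed

text \<open>Each ordered pair of neighbours comes from exactly one cell and one pair of distinct
  corners. In this form the first letter of the words can be split off, which gives the recursion
  behind the inductions on the level.\<close>

lemma sg_energy_level_eq:
  "sg_energy_level r u v = (5/3) ^ r * (\<Sum>w\<in>sg_words r. sg_Q (u \<circ> sg_Fw w) (v \<circ> sg_Fw w))"
proof -
  let ?D = "{(i, j). i < (3::nat) \<and> j < (3::nat) \<and> i \<noteq> j}"
  let ?e = "\<lambda>w (i, j). (u (sg_Fw w (sg_q i)) - u (sg_Fw w (sg_q j))) *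
    (v (sg_Fw w (sg_q i)) - v (sg_Fw w (sg_q j)))"
  have inj: "inj_on (\<lambda>(w, i, j). (sg_Fw w (sg_q i), sg_Fw w (sg_q j))) (sg_words r \<times> ?D)"
  proof (rule inj_onI)
    fix p q
    assume pq: "p \<in> sg_words r \<times> ?D" "q \<in> sg_words r \<times> ?D"
      "(\<lambda>(w, i, j). (sg_Fw w (sg_q i), sg_Fw w (sg_q j))) p =
       (\<lambda>(w, i, j). (sg_Fw w (sg_q i), sg_Fw w (sg_q j))) q"
    obtain v i j w k l where "p = (v, i, j)" "q = (w, k, l)"
      by (metis prod_cases3)
    then show "p = q"
      using pq sg_cell_edge_unique[of v r w i j k l] by simp
  qed
  have *: "sum (?e w) ?D = (\<Sum>i<3. \<Sum>j<3. ?e w (i, j))" for w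
  proof -
    have "(\<Sum>i<3. \<Sum>j<3. ?e w (i, j)) = sum (?e w) ({..<3} \<times> {..<3})"
      by (simp add: sum.cartesian_product)
    also have "\<dots> = sum (?e w) ?D"
      by (rule sum.mono_neutral_right) auto
    finally show ?thesis ..
  qed
  have "(\<Sum>(x, y)\<in>{(x, y). sg_adj r x y}. (u x - u y) * (v x - v y)) =
      (\<Sum>(w, p)\<in>sg_words r \<times> ?D. ?e w p)"
    unfolding sg_adj_pairs by (subst sum.reindex[OF inj]) (auto intro!: sum.cong)
  also have "\<dots> = (\<Sum>w\<in>sg_words r. \<Sum>i<3. \<Sum>j<3. ?e w (i, j))"
    unfolding *[symmetric] by (subst sum.cartesian_product) simp
  finally show ?thesis
    unfolding sg_energy_level_def by (simp add: sg_Q_def sum_distrib_left)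
qed

lemma sg_energy_level_0 [simp]: "sg_energy_level 0 u v = sg_Q u v"
  by (simp add: sg_energy_level_eq)

lemma sg_energy_level_Suc:
  "sg_energy_level (Suc r) u v =
     5/3 * (\<Sum>i<3. sg_energy_level r (u \<circ> sg_F i) (v \<circ> sg_F i))"
  unfolding sg_energy_level_eq sum_sg_words_Suc
  by (simp add: sum_distrib_left o_assoc mult.assoc)

lemma sg_Q_expand: "sg_Q u v = (u (sg_q 0) - u (sg_q 1)) * (v (sg_q 0) - v (sg_q 1)) +
    (u (sg_q 0) - u (sg_q 2)) * (v (sg_q 0) - v (sg_q 2)) +
    (u (sg_q 1) - u (sg_q 2)) * (v (sg_q 1) - v (sg_q 2))"
  by (simp add: sg_Q_def lessThan_3 algebra_simps)

text \<open>The harmonic extension to the midpoints, with weights 2/5, 2/5, 1/5, has exactly 3/5 of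
  the original energy, which the factor 5/3 compensates. Any other midpoint values add a nonnegative
  quadratic form.\<close>

lemma sg_Q_mono: "sg_Q u u \<le> 5/3 * (\<Sum>i<3. sg_Q (u \<circ> sg_F i) (u \<circ> sg_F i))"
proof -
  have *: "(a - b)\<^sup>2 + (a - c)\<^sup>2 + (b - c)\<^sup>2 \<le> 5/3 *
    (((a - z)\<^sup>2 + (a - y)\<^sup>2 + (z - y)\<^sup>2) + ((z - b)\<^sup>2 + (z - x)\<^sup>2 + (b - x)\<^sup>2) +
     ((y - x)\<^sup>2 + (y - c)\<^sup>2 + (x - c)\<^sup>2))" for a b c x y z :: real
  proof -
    \<comment> \<open>the deviations from the energy minimising (harmonic) extension of \<open>a, b, c\<close>\<close>
    let ?X = "x - (a + 2 * b + 2 * c) / 5" and ?Y = "y - (2 * a + b + 2 * c) / 5"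
      and ?Z = "z - (2 * a + 2 * b + c) / 5"
    have "5/3 *
      (((a - z)\<^sup>2 + (a - y)\<^sup>2 + (z - y)\<^sup>2) + ((z - b)\<^sup>2 + (z - x)\<^sup>2 + (b - x)\<^sup>2) +
        ((y - x)\<^sup>2 + (y - c)\<^sup>2 + (x - c)\<^sup>2)) -
      ((a - b)\<^sup>2 + (a - c)\<^sup>2 + (b - c)\<^sup>2) =
      5/3 * ((?X - ?Y)\<^sup>2 + (?Y - ?Z)\<^sup>2 + (?X - ?Z)\<^sup>2 + 2 * (?X\<^sup>2 + ?Y\<^sup>2 + ?Z\<^sup>2))"
      by (simp add: power2_eq_square field_simps)
    also have "\<dots> \<ge> 0"
      by simp
    finally show ?thesis
      by simp
  qed
  have "sg_F (Suc 0) (sg_q 0) = sg_F 0 (sg_q (Suc 0))" "sg_F 2 (sg_q 0) = sg_F 0 (sg_q 2)"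
    "sg_F 2 (sg_q (Suc 0)) = sg_F (Suc 0) (sg_q 2)"
    by (rule sg_F_q_commute)+
  then show ?thesis
    using *[of "u (sg_q 0)" "u (sg_q 1)" "u (sg_q 2)" "u (sg_F 0 (sg_q 1))"
        "u (sg_F 0 (sg_q 2))" "u (sg_F 1 (sg_q 2))"]
    by (simp add: sg_Q_expand lessThan_3 power2_eq_square)
qed

lemma sg_Q_nonneg: "0 \<le> sg_Q u u"
  by (simp add: sg_Q_expand)

lemma sg_energy_level_nonneg: "0 \<le> sg_energy_level r u u"
  unfolding sg_energy_level_eq by (intro mult_nonneg_nonneg sum_nonneg sg_Q_nonneg) auto

lemma sg_energy_level_mono: "sg_energy_level r u u \<le> sg_energy_level (Suc r) u u"
proof (induction r arbitrary: u)
  case 0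
  then show ?case
    using sg_Q_mono[of u] by (simp add: sg_energy_level_Suc)
next
  case (Suc r)
  show ?case
    unfolding sg_energy_level_Suc[of "Suc r"] sg_energy_level_Suc[of r u u]
    by (intro mult_left_mono sum_mono Suc) auto
qed

lemma incseq_sg_energy_level: "incseq (\<lambda>r. sg_energy_level r u u)"
  by (rule incseq_SucI) (rule sg_energy_level_mono)

lemma sg_energy_level_cong:
  assumes "\<And>x. x \<in> SG \<Longrightarrow> u x = u' x" "\<And>x. x \<in> SG \<Longrightarrow> v x = v' x"
  shows "sg_energy_level r u v = sg_energy_level r u' v'"
  using assms
proof (induction r arbitrary: u v u' v')
  case 0
  then show ?case
    using sg_q_in_SG by (simp add: sg_Q_expand)
next
  case (Suc r)
  show ?case
    unfolding sg_energy_level_Suc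
    by (intro arg_cong2[where f="(*)"] sum.cong refl Suc.IH) (use Suc.prems sg_F_in_SG in auto)
qed

lemma sg_Q_lincomb:
  "sg_Q (\<lambda>x. a * u x + b * v x) w = a * sg_Q u w + b * sg_Q v w"
  by (simp add: sg_Q_expand algebra_simps)

lemma sg_energy_level_lincomb:
  "sg_energy_level r (\<lambda>x. a * u x + b * v x) w =
     a * sg_energy_level r u w + b * sg_energy_level r v w"
proof (induction r arbitrary: u v w)
  case (Suc r)
  then show ?case
    unfolding sg_energy_level_Suc o_def
    by (simp add: sum.distrib sum_distrib_left distrib_left mult.left_commute)
qed (simp add: sg_Q_lincomb)

lemma sg_energy_level_commute: "sg_energy_level r u v = sg_energy_level r v u"
  by (simp add: sg_energy_level_eq sg_Q_def mult.commute)

lemma sg_energy_level_lincomb_right: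
  "sg_energy_level r w (\<lambda>x. a * u x + b * v x) =
     a * sg_energy_level r w u + b * sg_energy_level r w v"
  using sg_energy_level_lincomb[of r a u b v w] by (simp add: sg_energy_level_commute)

lemma sg_energy_level_square:
  "sg_energy_level r (\<lambda>x. a * u x + b * v x) (\<lambda>x. a * u x + b * v x) =
     a\<^sup>2 * sg_energy_level r u u + 2 * a * b * sg_energy_level r u v + b\<^sup>2 * sg_energy_level r v v"
  by (simp add: sg_energy_level_lincomb sg_energy_level_lincomb_right
      sg_energy_level_commute[of r v u] power2_eq_square algebra_simps)

lemma sg_Q_edge_bound:
  assumes "i < 3" "j < 3"
  shows "(u (sg_q i) - u (sg_q j))\<^sup>2 \<le> sg_Q u u"
proof -
  have "sg_Q u u = (u (sg_q 0) - u (sg_q 1))\<^sup>2 + (u (sg_q 0) - u (sg_q 2))\<^sup>2 +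
      (u (sg_q 1) - u (sg_q 2))\<^sup>2"
    by (simp add: sg_Q_expand power2_eq_square)
  then show ?thesis
    using assms by (auto simp: less_3_cases power2_commute)
qed

text \<open>At a fixed level only finitely many vertices matter, so pointwise convergence suffices.
  Energy bounds are later passed to a limit function level by level.\<close>

lemma sg_energy_level_tendsto:
  assumes "\<And>x. x \<in> SG \<Longrightarrow> ((\<lambda>n. u n x) \<longlongrightarrow> u' x) F" "\<And>x. x \<in> SG \<Longrightarrow> ((\<lambda>n. v n x) \<longlongrightarrow> v' x) F"
  shows "((\<lambda>n. sg_energy_level r (u n) (v n)) \<longlongrightarrow> sg_energy_level r u' v') F"
  using assms
proof (induction r arbitrary: u u' v v')
  case 0
  show ?case
    unfolding sg_energy_level_0 sg_Q_expand by (intro tendsto_intros 0 sg_q_in_SG) auto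
next
  case (Suc r)
  show ?case
    unfolding sg_energy_level_Suc
    by (intro tendsto_intros Suc.IH) (use Suc.prems sg_F_in_SG in auto)
qed

subsection \<open>The energy form\<close>

text \<open>Level energies increase, so a uniform bound already forces convergence.\<close>

lemma sg_dom_energyI:
  assumes "continuous_on SG u" "\<And>r. sg_energy_level r u u \<le> B"
  shows "u \<in> sg_dom_energy"
proof -
  have "convergent (\<lambda>r. sg_energy_level r u u)"
    by (rule incseq_convergent[OF incseq_sg_energy_level, of u B]) (auto simp: assms(2) convergent_def)
  then show ?thesis
    using assms(1) by (simp add: sg_dom_energy_def)
qed

lemma sg_dom_energy_continuous: "u \<in> sg_dom_energy \<Longrightarrow> continuous_on SG u"
  by (simp add: sg_dom_energy_def)

lemma sg_energy_level_le:
  assumes "u \<in> sg_dom_energy"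
  shows "sg_energy_level r u u \<le> sg_energy u u"
  using assms incseq_sg_energy_level[of u]
  by (intro incseq_le) (auto simp: sg_dom_energy_def sg_energy_def convergent_LIMSEQ_iff)

lemma sg_energy_nonneg: "u \<in> sg_dom_energy \<Longrightarrow> 0 \<le> sg_energy u u"
  using sg_energy_level_le[of u 0] sg_energy_level_nonneg[of 0 u] by simp

lemma sg_energy_le:
  assumes "\<And>r. sg_energy_level r u u \<le> B" "u \<in> sg_dom_energy"
  shows "sg_energy u u \<le> B"
  using assms
  by (intro LIMSEQ_le_const2[of "\<lambda>r. sg_energy_level r u u"])
    (auto simp: sg_dom_energy_def sg_energy_def convergent_LIMSEQ_iff)

lemma sg_dom_energy_lincomb:
  assumes "u \<in> sg_dom_energy" "v \<in> sg_dom_energy"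
  shows "(\<lambda>x. a * u x + b * v x) \<in> sg_dom_energy"
proof (rule sg_dom_energyI)
  show "continuous_on SG (\<lambda>x. a * u x + b * v x)"
    using assms by (intro continuous_intros sg_dom_energy_continuous)
  fix r
  \<comment> \<open>Nonnegativity of the energy of \<open>a u - b v\<close> bounds the cross term in
    that of \<open>a u + b v\<close>.\<close>
  have "0 \<le> a\<^sup>2 * sg_energy_level r u u + 2 * a * (-b) * sg_energy_level r u v + (-b)\<^sup>2 * sg_energy_level r v v"
    unfolding sg_energy_level_square[symmetric] by (rule sg_energy_level_nonneg)
  then have "sg_energy_level r (\<lambda>x. a * u x + b * v x) (\<lambda>x. a * u x + b * v x)
      \<le> 2 * (a\<^sup>2 * sg_energy_level r u u + b\<^sup>2 * sg_energy_level r v v)"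
    unfolding sg_energy_level_square by (simp add: algebra_simps)
  also have "\<dots> \<le> 2 * (a\<^sup>2 * sg_energy u u + b\<^sup>2 * sg_energy v v)"
    by (intro mult_left_mono add_mono sg_energy_level_le assms) auto
  finally show "sg_energy_level r (\<lambda>x. a * u x + b * v x) (\<lambda>x. a * u x + b * v x) \<le> \<dots>" .
qed

text \<open>Polarisation reduces the mixed energy to diagonal ones, whose convergence is known. Only
  then is the \<open>lim\<close> in \<open>sg_energy\<close> more than an unspecified value.\<close>

lemma tendsto_sg_energy:
  assumes "u \<in> sg_dom_energy" "v \<in> sg_dom_energy"
  shows "(\<lambda>r. sg_energy_level r u v) \<longlonglongrightarrow> sg_energy u v"
proof -
  let ?s = "\<lambda>x. 1 * u x + 1 * v x"
  have *: "convergent (\<lambda>r. sg_energy_level r w w)" if "w \<in> sg_dom_energy" for w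
    using that by (simp add: sg_dom_energy_def)
  have "sg_energy_level r u v =
      (sg_energy_level r ?s ?s - sg_energy_level r u u - sg_energy_level r v v) * (1/2)" for r
    unfolding sg_energy_level_square by simp
  moreover have "convergent (\<lambda>r.
      (sg_energy_level r ?s ?s - sg_energy_level r u u - sg_energy_level r v v) * (1/2))"
    by (intro convergent_mult convergent_diff convergent_const * sg_dom_energy_lincomb assms)
  ultimately have "convergent (\<lambda>r. sg_energy_level r u v)"
    by presburger
  then show ?thesis
    by (simp add: sg_energy_def convergent_LIMSEQ_iff)
qed

lemma sg_energy_lincomb:
  assumes "u \<in> sg_dom_energy" "v \<in> sg_dom_energy" "w \<in> sg_dom_energy"
  shows "sg_energy (\<lambda>x. a * u x + b * v x) w = a * sg_energy u w + b * sg_energy v w"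
proof (rule LIMSEQ_unique)
  show "(\<lambda>r. sg_energy_level r (\<lambda>x. a * u x + b * v x) w) \<longlonglongrightarrow> sg_energy (\<lambda>x. a * u x + b * v x) w"
    by (intro tendsto_sg_energy sg_dom_energy_lincomb assms)
  show "(\<lambda>r. sg_energy_level r (\<lambda>x. a * u x + b * v x) w) \<longlonglongrightarrow> a * sg_energy u w + b * sg_energy v w"
    unfolding sg_energy_level_lincomb by (intro tendsto_intros tendsto_sg_energy assms)
qed

lemma sg_energy_square:
  assumes "u \<in> sg_dom_energy" "v \<in> sg_dom_energy"
  shows "sg_energy (\<lambda>x. a * u x + b * v x) (\<lambda>x. a * u x + b * v x) =
     a\<^sup>2 * sg_energy u u + 2 * a * b * sg_energy u v + b\<^sup>2 * sg_energy v v"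
proof (rule LIMSEQ_unique)
  show "(\<lambda>r. sg_energy_level r (\<lambda>x. a * u x + b * v x) (\<lambda>x. a * u x + b * v x))
      \<longlonglongrightarrow> sg_energy (\<lambda>x. a * u x + b * v x) (\<lambda>x. a * u x + b * v x)"
    by (intro tendsto_sg_energy sg_dom_energy_lincomb assms)
  show "(\<lambda>r. sg_energy_level r (\<lambda>x. a * u x + b * v x) (\<lambda>x. a * u x + b * v x))
      \<longlonglongrightarrow> a\<^sup>2 * sg_energy u u + 2 * a * b * sg_energy u v + b\<^sup>2 * sg_energy v v"
    unfolding sg_energy_level_square by (intro tendsto_intros tendsto_sg_energy assms)
qed

lemma sg_dom_energy_const: "(\<lambda>_. c) \<in> sg_dom_energy"
proof (rule sg_dom_energyI)
  show "sg_energy_level r (\<lambda>_. c) (\<lambda>_. c) \<le> 0" for r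
    by (simp add: sg_energy_level_eq sg_Q_expand o_def)
qed simp

section \<open>Restriction to cells and the oscillation estimate\<close>

lemma continuous_on_sg_F:
  assumes "continuous_on SG f" "i < 3"
  shows "continuous_on SG (\<lambda>x. f (sg_F i x))"
  using assms sg_F_in_SG by (intro continuous_on_compose2[OF assms(1)] continuous_intros) auto

lemma sg_energy_level_comp_F:
  assumes "i < 3"
  shows "sg_energy_level r (u \<circ> sg_F i) (u \<circ> sg_F i) \<le> 3/5 * sg_energy_level (Suc r) u u"
proof -
  have "sg_energy_level r (u \<circ> sg_F i) (u \<circ> sg_F i)
      \<le> (\<Sum>i<3. sg_energy_level r (u \<circ> sg_F i) (u \<circ> sg_F i))"
    using assms by (intro member_le_sum) (auto simp: sg_energy_level_nonneg)
  then show ?thesis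
    by (simp add: sg_energy_level_Suc)
qed

lemma sg_dom_energy_comp_F:
  assumes "u \<in> sg_dom_energy" "i < 3"
  shows "u \<circ> sg_F i \<in> sg_dom_energy"
    and "sg_energy (u \<circ> sg_F i) (u \<circ> sg_F i) \<le> 3/5 * sg_energy u u"
proof -
  have *: "sg_energy_level r (u \<circ> sg_F i) (u \<circ> sg_F i) \<le> 3/5 * sg_energy u u" for r
    using sg_energy_level_comp_F[OF assms(2), of r u] sg_energy_level_le[OF assms(1), of "Suc r"]
    by simp
  show "u \<circ> sg_F i \<in> sg_dom_energy"
    using continuous_on_sg_F[OF sg_dom_energy_continuous[OF assms(1)] assms(2)] *
    by (intro sg_dom_energyI[of _ "3/5 * sg_energy u u"]) (simp_all add: o_def)
  then show "sg_energy (u \<circ> sg_F i) (u \<circ> sg_F i) \<le> 3/5 * sg_energy u u"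
    using * by (intro sg_energy_le)
qed

text \<open>The sum of the geometric series of ratio \<open>sqrt (3/5)\<close>, used through the
  identity \<open>K * sqrt (3/5) + 1 = K\<close>.\<close>

definition sg_osc_const :: real where
  "sg_osc_const = 1 / (1 - sqrt (3/5))"

lemma sqrt_3_5_less_1: "sqrt (3/5) < 1"
  by (subst real_sqrt_lt_1_iff) simp

lemma sg_osc_const_pos: "0 < sg_osc_const"
  using sqrt_3_5_less_1 by (simp add: sg_osc_const_def)

lemma sg_osc_const_fix: "sg_osc_const * sqrt (3/5) + 1 = sg_osc_const"
proof -
  have "1 - sqrt (3/5) \<noteq> 0"
    using sqrt_3_5_less_1 by linarith
  then have "sg_osc_const * (1 - sqrt (3/5)) = 1"
    unfolding sg_osc_const_def by simp
  then show ?thesis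
    by (simp add: right_diff_distrib)
qed

text \<open>The corner \<open>sg_q a\<close> is fixed by \<open>sg_F a\<close> and so links the
  first cell to the outer triangle. Inside the cell the induction hypothesis applies to
  \<open>u \<circ> sg_F a\<close>, which has at most 3/5 of the energy; one outer edge then leads to
  \<open>sg_q j\<close>.\<close>

lemma sg_osc_vertex_bound:
  assumes "w \<in> sg_words r" "u \<in> sg_dom_energy" "i < 3" "j < 3"
  shows "\<bar>u (sg_Fw w (sg_q i)) - u (sg_q j)\<bar> \<le> sg_osc_const * sqrt (sg_energy u u)"
  using assms
proof (induction r arbitrary: w u j)
  have edge: "\<bar>u (sg_q i) - u (sg_q j)\<bar> \<le> sqrt (sg_energy u u)"
    if "u \<in> sg_dom_energy" "i < 3" "j < 3" for u i j
    using sg_Q_edge_bound[OF that(2,3), of u] sg_energy_level_le[OF that(1), of 0]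
    by (intro real_le_rsqrt) simp
  {
    case 0
    have "1 \<le> sg_osc_const"
      using sqrt_3_5_less_1 by (simp add: sg_osc_const_def)
    then have "1 * sqrt (sg_energy u u) \<le> sg_osc_const * sqrt (sg_energy u u)"
      using sg_energy_nonneg 0 by (intro mult_right_mono) auto
    then show ?case
      using edge[of u i j] 0 by simp
  next
    case (Suc r)
    then obtain a v where w: "w = a # v" "a < 3" "v \<in> sg_words r"
      by (auto simp: sg_words_Suc)
    have "\<bar>u (sg_Fw w (sg_q i)) - u (sg_q a)\<bar> =
        \<bar>(u \<circ> sg_F a) (sg_Fw v (sg_q i)) - (u \<circ> sg_F a) (sg_q a)\<bar>"
      by (simp add: w)
    also have "\<dots> \<le> sg_osc_const * sqrt (sg_energy (u \<circ> sg_F a) (u \<circ> sg_F a))"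
      using Suc.prems w by (intro Suc.IH sg_dom_energy_comp_F)
    also have "\<dots> \<le> sg_osc_const * sqrt (3/5 * sg_energy u u)"
      using sg_osc_const_pos sg_dom_energy_comp_F(2)[OF Suc.prems(2) w(2)]
      by (intro mult_left_mono real_sqrt_le_mono) auto
    also have "\<dots> = (sg_osc_const * sqrt (3/5)) * sqrt (sg_energy u u)"
      by (simp only: real_sqrt_mult mult.assoc)
    finally have "\<bar>u (sg_Fw w (sg_q i)) - u (sg_q j)\<bar> \<le>
        (sg_osc_const * sqrt (3/5)) * sqrt (sg_energy u u) + 1 * sqrt (sg_energy u u)"
      using edge[OF Suc.prems(2) w(2) Suc.prems(4)] by linarith
    also have "\<dots> = sg_osc_const * sqrt (sg_energy u u)"
      unfolding distrib_right[symmetric] sg_osc_const_fix ..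
    finally show ?case .
  }
qed

text \<open>Comparison with a corner, where \<open>u\<close> vanishes, bounds \<open>u\<close> at
  all vertices; continuity carries the bound to their closure.\<close>

lemma sg_osc_bound:
  assumes "u \<in> sg_dom_energy" "\<forall>x\<in>sg_V 0. u x = 0" "x \<in> SG"
  shows "\<bar>u x\<bar> \<le> sg_osc_const * sqrt (sg_energy u u)"
proof -
  have "\<bar>u y\<bar> \<le> sg_osc_const * sqrt (sg_energy u u)" if "y \<in> sg_Vs" for y
  proof -
    from that obtain r w i where "w \<in> sg_words r" "i < 3" "y = sg_Fw w (sg_q i)"
      by (auto simp: sg_Vs_def sg_V_def)
    then show ?thesis
      using sg_osc_vertex_bound[of w r u i 0] assms by (simp add: sg_V_0)
  qed
  moreover have "continuous_on (closure sg_Vs) (\<lambda>x. \<bar>u x\<bar>)"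
    using sg_dom_energy_continuous[OF assms(1)] unfolding SG_eq_closure
    by (intro continuous_intros)
  ultimately show ?thesis
    using assms(3) continuous_le_on_closure[of sg_Vs "\<lambda>x. \<bar>u x\<bar>" x] unfolding SG_eq_closure
    by blast
qed

text \<open>Transplants a function to cell \<open>i\<close> by the inverse of \<open>sg_F i\<close>
  and continues it by zero. These are the test functions that localise the weak equation.\<close>

definition sg_ext :: "nat \<Rightarrow> (real^2 \<Rightarrow> real) \<Rightarrow> real^2 \<Rightarrow> real" where
  "sg_ext i v x = (if x \<in> sg_F i ` SG then v (2 *\<^sub>R x - sg_q i) else 0)"

lemma sg_F_inverse: "2 *\<^sub>R sg_F i x - sg_q i = x"
  by (simp add: sg_F_def algebra_simps scaleR_2)

text \<open>At a junction point two cells prescribe a value; they agree because \<open>v\<close> is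
  zero at the corners.\<close>

lemma sg_ext_F:
  assumes "i < 3" "j < 3" "x \<in> SG" "\<forall>x\<in>sg_V 0. v x = 0"
  shows "sg_ext i v (sg_F j x) = (if i = j then v x else 0)"
proof (cases "i = j")
  case True
  then show ?thesis
    using assms(3) by (simp add: sg_ext_def sg_F_inverse)
next
  case False
  have "v y = 0" if "y \<in> SG" "sg_F j x = sg_F i y" for y
    using sg_cells_inter[of j i x y] that assms False by (auto simp: sg_V_0)
  then show ?thesis
    using False by (auto simp: sg_ext_def sg_F_inverse)
qed

lemma continuous_on_sg_ext:
  assumes "continuous_on SG v" "\<forall>x\<in>sg_V 0. v x = 0" "i < 3"
  shows "continuous_on SG (sg_ext i v)"
proof -
  have "continuous_on (sg_F j ` SG) (sg_ext i v)" if "j < 3" for j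
  proof (cases "i = j")
    case True
    have "continuous_on (sg_F i ` SG) (\<lambda>x. v (2 *\<^sub>R x - sg_q i))"
      by (rule continuous_on_compose2[OF assms(1)])
        (auto intro!: continuous_intros simp: sg_F_inverse)
    then show ?thesis
      using True by (subst continuous_on_cong[OF refl]) (auto simp: sg_ext_def)
  next
    case False
    have "continuous_on (sg_F j ` SG) (\<lambda>_. 0 :: real)"
      by simp
    then show ?thesis
      using False sg_ext_F[OF assms(3) that _ assms(2)]
      by (subst continuous_on_cong[OF refl, of _ _ "\<lambda>_. 0"]) auto
  qed
  moreover have "closed (sg_F j ` SG)" for j
    by (intro compact_imp_closed compact_continuous_image continuous_intros compact_SG)
  ultimately have "continuous_on (\<Union>j\<in>{..<3}. sg_F j ` SG) (sg_ext i v)"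
    by (intro continuous_on_closed_Union) auto
  then show ?thesis
    unfolding SG_eq[symmetric] .
qed

text \<open>The extension vanishes on the other two cells, so a single summand of the recursion
  survives.\<close>

lemma sg_energy_level_ext:
  assumes "\<forall>x\<in>sg_V 0. v x = 0" "i < 3"
  shows "sg_energy_level (Suc r) u (sg_ext i v) = 5/3 * sg_energy_level r (u \<circ> sg_F i) v"
proof -
  have "sg_energy_level r (u \<circ> sg_F j) (sg_ext i v \<circ> sg_F j) =
      (if j = i then sg_energy_level r (u \<circ> sg_F i) v else 0)" if "j < 3" for j
  proof (cases "j = i")
    case True
    then show ?thesis
      using sg_ext_F[OF assms(2) that _ assms(1)] by (auto intro!: sg_energy_level_cong)
  next
    case False
    have "sg_energy_level r (u \<circ> sg_F j) (sg_ext i v \<circ> sg_F j) = sg_energy_level r (u \<circ> sg_F j) (\<lambda>_. 0)"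
      using False sg_ext_F[OF assms(2) that _ assms(1)] by (intro sg_energy_level_cong) auto
    also have "\<dots> = 0"
      by (simp add: sg_energy_level_eq sg_Q_expand)
    finally show ?thesis
      using False by simp
  qed
  then show ?thesis
    using assms(2) by (simp add: sg_energy_level_Suc)
qed

lemma sg_dom_energy_ext:
  assumes "v \<in> sg_dom_energy" "\<forall>x\<in>sg_V 0. v x = 0" "i < 3"
  shows "sg_ext i v \<in> sg_dom_energy"
proof (rule sg_dom_energyI)
  show "continuous_on SG (sg_ext i v)"
    using assms by (intro continuous_on_sg_ext sg_dom_energy_continuous)
  fix r
  have "sg_energy_level r (sg_ext i v) (sg_ext i v) \<le> sg_energy_level (Suc r) (sg_ext i v) (sg_ext i v)"
    by (rule sg_energy_level_mono)
  also have "\<dots> = 5/3 * sg_energy_level r (sg_ext i v \<circ> sg_F i) v"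
    by (rule sg_energy_level_ext[OF assms(2,3)])
  also have "sg_energy_level r (sg_ext i v \<circ> sg_F i) v = sg_energy_level r v v"
    using sg_ext_F[OF assms(3,3) _ assms(2)] by (intro sg_energy_level_cong) auto
  also have "5/3 * \<dots> \<le> 5/3 * sg_energy v v"
    using sg_energy_level_le[OF assms(1)] by simp
  finally show "sg_energy_level r (sg_ext i v) (sg_ext i v) \<le> 5/3 * sg_energy v v" .
qed

lemma sg_energy_ext:
  assumes "u \<in> sg_dom_energy" "v \<in> sg_dom_energy" "\<forall>x\<in>sg_V 0. v x = 0" "i < 3"
  shows "sg_energy u (sg_ext i v) = 5/3 * sg_energy (u \<circ> sg_F i) v"
proof (rule LIMSEQ_unique)
  show "(\<lambda>r. sg_energy_level (Suc r) u (sg_ext i v)) \<longlonglongrightarrow> sg_energy u (sg_ext i v)"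
    using assms by (intro LIMSEQ_Suc tendsto_sg_energy sg_dom_energy_ext)
  show "(\<lambda>r. sg_energy_level (Suc r) u (sg_ext i v)) \<longlonglongrightarrow> 5/3 * sg_energy (u \<circ> sg_F i) v"
    unfolding sg_energy_level_ext[OF assms(3,4)] using assms
    by (intro tendsto_intros tendsto_sg_energy sg_dom_energy_comp_F)
qed

lemma sg_ext_V_0:
  assumes "\<forall>x\<in>sg_V 0. v x = 0" "i < 3" "x \<in> sg_V 0"
  shows "sg_ext i v x = 0"
proof -
  from assms(3) obtain j where "j < 3" "x = sg_F j (sg_q j)"
    by (auto simp: sg_V_0)
  then show ?thesis
    using sg_ext_F[of i j "sg_q j" v] assms sg_q_in_SG[of j] by (auto simp: sg_V_0)
qed

subsection \<open>The self-similar measure and the Laplacian\<close>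

locale sg_measure =
  fixes \<mu> :: "(real^2) measure"
  assumes sg_measure: "is_sg_measure \<mu>"
begin

sublocale prob_space \<mu>
  using sg_measure by (simp add: is_sg_measure_def)

lemma sets_eq_borel [simp, measurable_cong]: "sets \<mu> = sets borel"
  using sg_measure by (simp add: is_sg_measure_def)

lemma AE_SG: "AE x in \<mu>. x \<in> SG"
proof (rule AE_prob_1)
  have "\<forall>r. \<forall>w\<in>sg_words r. prob (sg_Fw w ` SG) = (1/3) ^ r"
    using sg_measure by (simp add: is_sg_measure_def)
  from this[THEN spec, of 0] show "prob SG = 1"
    by simp
qed

lemma borel_measurable_sg_F [measurable]: "sg_F i \<in> borel_measurable borel"
  by (intro borel_measurable_continuous_onI continuous_intros)

text \<open>Self-similarity is postulated for sets; approximation by simple functions turns it into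
  a change of variables.\<close>

lemma nn_integral_self_similar:
  fixes f :: "real^2 \<Rightarrow> ennreal"
  assumes "f \<in> borel_measurable borel"
  shows "(\<integral>\<^sup>+x. f x \<partial>\<mu>) = (\<Sum>i<3. ennreal (1/3) * (\<integral>\<^sup>+x. f (sg_F i x) \<partial>\<mu>))"
  using assms
proof (induction f rule: borel_measurable_induct)
  case (cong f g)
  then have "f = g"
    by auto
  then show ?case
    using cong by simp
next
  case (set A)
  have "emeasure \<mu> A = ennreal (\<Sum>i<3. (1/3) * prob (sg_F i -` A))"
    using sg_measure set by (simp add: is_sg_measure_def emeasure_eq_measure)
  also have "\<dots> = (\<Sum>i<3. ennreal (1/3) * emeasure \<mu> (sg_F i -` A))"
    by (subst sum_ennreal[symmetric])
      (simp_all add: emeasure_eq_measure ennreal_mult[symmetric] del: sum_ennreal)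
  also have "\<dots> = (\<Sum>i<3. ennreal (1/3) * (\<integral>\<^sup>+x. indicator A (sg_F i x) \<partial>\<mu>))"
  proof (intro sum.cong refl arg_cong2[where f="(*)"])
    fix i
    have "sg_F i -` A \<in> sets \<mu>"
      using measurable_sets[OF borel_measurable_sg_F set, of i] by simp
    then have "emeasure \<mu> (sg_F i -` A) = (\<integral>\<^sup>+x. indicator (sg_F i -` A) x \<partial>\<mu>)"
      by simp
    then show "emeasure \<mu> (sg_F i -` A) = (\<integral>\<^sup>+x. indicator A (sg_F i x) \<partial>\<mu>)"
      by (simp add: indicator_vimage)
  qed
  finally show ?case
    using set by simp
next
  case (mult u c)
  have [measurable]: "u \<in> borel_measurable borel" by fact
  show ?case
    using mult by (simp add: nn_integral_cmult sum_distrib_left mult.left_commute)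
next
  case (add u v)
  have [measurable]: "u \<in> borel_measurable borel" "v \<in> borel_measurable borel" by fact+
  show ?case
    using add by (simp add: nn_integral_add sum.distrib distrib_left)
next
  case (seq U)
  have [measurable]: "U n \<in> borel_measurable borel" for n by fact
  have inc: "incseq (\<lambda>n x. U n (sg_F i x))" for i
    using seq(3) by (auto simp: incseq_def le_fun_def)
  have "(\<integral>\<^sup>+x. (SUP n. U n) x \<partial>\<mu>) = (SUP n. \<integral>\<^sup>+x. U n x \<partial>\<mu>)"
    unfolding SUP_apply using seq(3) by (intro nn_integral_monotone_convergence_SUP) auto
  also have "\<dots> = (SUP n. \<Sum>i<3. ennreal (1/3) * (\<integral>\<^sup>+x. U n (sg_F i x) \<partial>\<mu>))"
    using seq by simp
  also have "\<dots> = (\<Sum>i<3. SUP n. ennreal (1/3) * (\<integral>\<^sup>+x. U n (sg_F i x) \<partial>\<mu>))"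
    using inc by (intro ennreal_SUP_sum)
      (auto simp: incseq_def le_fun_def intro!: mult_left_mono nn_integral_mono)
  also have "\<dots> = (\<Sum>i<3. ennreal (1/3) * (\<integral>\<^sup>+x. (SUP n. U n) (sg_F i x) \<partial>\<mu>))"
    unfolding SUP_apply using inc
    by (intro sum.cong refl)
      (subst nn_integral_monotone_convergence_SUP, auto simp: SUP_mult_left_ennreal image_comp)
  finally show ?case .
qed

lemma integral_self_similar:
  fixes f :: "real^2 \<Rightarrow> real"
  assumes [measurable]: "f \<in> borel_measurable borel" and B: "\<And>x. \<bar>f x\<bar> \<le> B"
  shows "(\<integral>x. f x \<partial>\<mu>) = (\<Sum>i<3. \<integral>x. f (sg_F i x) \<partial>\<mu>) / 3"
proof -
  \<comment> \<open>Adding \<open>B\<close> makes the integrand nonnegative. The shift cancels at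
    the end since \<open>\<mu>\<close> has mass 1 and the three weights sum to 1.\<close>
  have nn: "0 \<le> f x + B" for x
    using B[of x] by linarith
  have int: "integrable \<mu> f" "integrable \<mu> (\<lambda>x. f (sg_F i x))" for i
    using B by (auto intro!: integrable_const_bound[where B=B])
  have *: "(\<integral>\<^sup>+x. ennreal (h x + B) \<partial>\<mu>) = ennreal ((\<integral>x. h x \<partial>\<mu>) + B)" and
    **: "0 \<le> (\<integral>x. h x \<partial>\<mu>) + B"
    if "integrable \<mu> h" "\<And>x. 0 \<le> h x + B" for h
  proof -
    have "(\<integral>x. h x + B \<partial>\<mu>) = (\<integral>x. h x \<partial>\<mu>) + B"
      using that by (simp add: prob_space)
    then show "(\<integral>\<^sup>+x. ennreal (h x + B) \<partial>\<mu>) = ennreal ((\<integral>x. h x \<partial>\<mu>) + B)"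
      using that by (subst nn_integral_eq_integral) auto
    show "0 \<le> (\<integral>x. h x \<partial>\<mu>) + B"
      unfolding \<open>(\<integral>x. h x + B \<partial>\<mu>) = _\<close>[symmetric] using that by (intro integral_nonneg_AE) auto
  qed
  have "ennreal ((\<integral>x. f x \<partial>\<mu>) + B) = (\<integral>\<^sup>+x. ennreal (f x + B) \<partial>\<mu>)"
    using *[OF int(1) nn] ..
  also have "\<dots> = (\<Sum>i<3. ennreal (1/3) * (\<integral>\<^sup>+x. ennreal (f (sg_F i x) + B) \<partial>\<mu>))"
    by (rule nn_integral_self_similar) measurable
  also have "\<dots> = (\<Sum>i<3. ennreal (1/3 * ((\<integral>x. f (sg_F i x) \<partial>\<mu>) + B)))"
    using *[OF int(2) nn] **[OF int(2) nn]
    by (simp add: ennreal_mult[symmetric] del: sum_ennreal)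
  also have "\<dots> = ennreal (\<Sum>i<3. 1/3 * ((\<integral>x. f (sg_F i x) \<partial>\<mu>) + B))"
    using **[OF int(2) nn] by (intro sum_ennreal) auto
  finally have "(\<integral>x. f x \<partial>\<mu>) + B = (\<Sum>i<3. 1/3 * ((\<integral>x. f (sg_F i x) \<partial>\<mu>) + B))"
    using **[OF int(1) nn] **[OF int(2) nn] by (subst (asm) ennreal_inj) (auto intro!: sum_nonneg)
  then show ?thesis
    by (simp add: sum.distrib sum_distrib_left[symmetric] sum_divide_distrib[symmetric])
qed

section \<open>Integrals of continuous functions over the gasket\<close>

lemma SG_borel [measurable]: "SG \<in> sets borel"
  using compact_SG by (simp add: borel_compact)

lemma set_integrable_continuous:
  fixes f :: "real^2 \<Rightarrow> real"
  assumes "continuous_on SG f"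
  shows "set_integrable \<mu> SG f"
proof -
  have m: "(\<lambda>x. indicator SG x *\<^sub>R f x) \<in> borel_measurable \<mu>"
    using borel_measurable_continuous_on_indicator[OF SG_borel assms] by measurable
  obtain B where "\<forall>x\<in>SG. norm (f x) \<le> B"
    using compact_imp_bounded[OF compact_continuous_image[OF assms compact_SG]]
    by (auto simp: bounded_iff)
  then show ?thesis
    unfolding set_integrable_def
    by (intro integrable_const_bound[where B="\<bar>B\<bar>"] AE_I2 m) (force simp: indicator_def)
qed

lemma LINT_self_similar:
  fixes f :: "real^2 \<Rightarrow> real"
  assumes "continuous_on SG f"
  shows "(LINT x:SG|\<mu>. f x) = (\<Sum>i<3. LINT x:SG|\<mu>. f (sg_F i x)) / 3"
proof -
  let ?h = "\<lambda>x. indicator SG x *\<^sub>R f x"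
  have [measurable]: "?h \<in> borel_measurable borel"
    using borel_measurable_continuous_on_indicator[OF SG_borel assms] .
  obtain B where "\<forall>x\<in>SG. norm (f x) \<le> B"
    using compact_imp_bounded[OF compact_continuous_image[OF assms compact_SG]]
    by (auto simp: bounded_iff)
  then have "\<bar>?h x\<bar> \<le> \<bar>B\<bar>" for x
    by (auto simp: indicator_def intro: order_trans)
  then have "(\<integral>x. ?h x \<partial>\<mu>) = (\<Sum>i<3. \<integral>x. ?h (sg_F i x) \<partial>\<mu>) / 3"
    by (intro integral_self_similar) measurable
  \<comment> \<open>For \<open>x\<close> outside \<open>SG\<close> the point \<open>sg_F i x\<close>
    may still lie in \<open>SG\<close>, in another cell, so the integrands agree only almost
    everywhere.\<close>
  moreover have "(\<integral>x. ?h (sg_F i x) \<partial>\<mu>) = (\<integral>x. indicator SG x *\<^sub>R f (sg_F i x) \<partial>\<mu>)"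
    if i: "i < 3" for i
  proof (rule integral_cong_AE)
    show "(\<lambda>x. ?h (sg_F i x)) \<in> borel_measurable \<mu>"
      by measurable
    show "(\<lambda>x. indicator SG x *\<^sub>R f (sg_F i x)) \<in> borel_measurable \<mu>"
      using borel_measurable_continuous_on_indicator[OF SG_borel continuous_on_sg_F[OF assms i]]
      by measurable
    show "AE x in \<mu>. ?h (sg_F i x) = indicator SG x *\<^sub>R f (sg_F i x)"
      using AE_SG by eventually_elim (use i sg_F_in_SG in \<open>simp add: indicator_def\<close>)
  qed
  ultimately show ?thesis
    unfolding set_lebesgue_integral_def by simp
qed

lemma LINT_lincomb:
  fixes f g :: "real^2 \<Rightarrow> real"
  assumes "continuous_on SG f" "continuous_on SG g"
  shows "(LINT x:SG|\<mu>. a * f x + b * g x) = a * (LINT x:SG|\<mu>. f x) + b * (LINT x:SG|\<mu>. g x)"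
  using assms by (subst set_integral_add) (auto intro!: set_integrable_continuous continuous_intros)

lemma LINT_SG_cong:
  fixes f g :: "real^2 \<Rightarrow> real"
  assumes "\<And>x. x \<in> SG \<Longrightarrow> f x = g x"
  shows "(LINT x:SG|\<mu>. f x) = (LINT x:SG|\<mu>. g x)"
  using assms by (intro set_lebesgue_integral_cong) auto

lemma LINT_bound:
  fixes f :: "real^2 \<Rightarrow> real"
  assumes "continuous_on SG f" "\<And>x. x \<in> SG \<Longrightarrow> \<bar>f x\<bar> \<le> B"
  shows "\<bar>LINT x:SG|\<mu>. f x\<bar> \<le> B"
proof -
  have int: "integrable \<mu> (\<lambda>x. indicator SG x *\<^sub>R f x)"
    using set_integrable_continuous[OF assms(1)] by (simp add: set_integrable_def)
  have "\<bar>LINT x:SG|\<mu>. f x\<bar> \<le> (\<integral>x. \<bar>indicator SG x *\<^sub>R f x\<bar> \<partial>\<mu>)"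
    unfolding set_lebesgue_integral_def by (rule integral_abs_bound)
  also have "\<dots> \<le> (\<integral>x. B \<partial>\<mu>)"
  proof (rule integral_mono_AE)
    show "AE x in \<mu>. \<bar>indicator SG x *\<^sub>R f x\<bar> \<le> B"
      using AE_SG by eventually_elim (use assms(2) in simp)
  qed (use int in auto)
  finally show ?thesis
    by (simp add: prob_space)
qed

text \<open>The equation for \<open>u\<close> is tested with \<open>sg_ext i v\<close>. The energy
  side yields the factor 5/3, the integral side the factor 1/3, and their quotient is 1/5.\<close>

lemma sg_laplacian_comp_F:
  assumes "sg_laplacian \<mu> u g" "i < 3"
  shows "sg_laplacian \<mu> (u \<circ> sg_F i) (\<lambda>x. 1/5 * g (sg_F i x))"
  unfolding sg_laplacian_def
proof (intro conjI ballI impI)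
  have u: "u \<in> sg_dom_energy" and g: "continuous_on SG g"
    using assms(1) by (auto simp: sg_laplacian_def)
  show "u \<circ> sg_F i \<in> sg_dom_energy"
    using u assms(2) by (rule sg_dom_energy_comp_F)
  show "continuous_on SG (\<lambda>x. 1/5 * g (sg_F i x))"
    using g assms(2) by (intro continuous_intros continuous_on_sg_F)
  fix v assume v: "v \<in> sg_dom_energy" "\<forall>x\<in>sg_V 0. v x = 0"
  have ext: "sg_ext i v \<in> sg_dom_energy"
    by (rule sg_dom_energy_ext[OF v assms(2)])
  have "5/3 * sg_energy (u \<circ> sg_F i) v = sg_energy u (sg_ext i v)"
    by (rule sg_energy_ext[OF u v assms(2), symmetric])
  also have "\<dots> = - (LINT x:SG|\<mu>. g x * sg_ext i v x)"
    using assms(1) ext sg_ext_V_0[OF v(2) assms(2)] by (simp add: sg_laplacian_def)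
  also have "(LINT x:SG|\<mu>. g x * sg_ext i v x) =
      (\<Sum>j<3. LINT x:SG|\<mu>. g (sg_F j x) * sg_ext i v (sg_F j x)) / 3"
    by (intro LINT_self_similar continuous_intros g sg_dom_energy_continuous ext)
  also have "(\<Sum>j<3. LINT x:SG|\<mu>. g (sg_F j x) * sg_ext i v (sg_F j x)) =
      (\<Sum>j<3. if j = i then (LINT x:SG|\<mu>. g (sg_F i x) * v x) else 0)"
  proof (intro sum.cong refl)
    fix j :: nat assume "j \<in> {..<3}"
    then have j: "j < 3" by simp
    have "(LINT x:SG|\<mu>. g (sg_F j x) * sg_ext i v (sg_F j x)) =
        (LINT x:SG|\<mu>. if j = i then g (sg_F i x) * v x else 0)"
      using sg_ext_F[OF assms(2) j _ v(2)] by (intro LINT_SG_cong) auto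
    also have "\<dots> = (if j = i then (LINT x:SG|\<mu>. g (sg_F i x) * v x) else 0)"
      by (simp add: set_lebesgue_integral_def)
    finally show "(LINT x:SG|\<mu>. g (sg_F j x) * sg_ext i v (sg_F j x)) = \<dots>" .
  qed
  also have "\<dots> = (LINT x:SG|\<mu>. g (sg_F i x) * v x)"
    using assms(2) by simp
  finally have "sg_energy (u \<circ> sg_F i) v = - (1/5 * (LINT x:SG|\<mu>. g (sg_F i x) * v x))"
    by linarith
  also have "1/5 * (LINT x:SG|\<mu>. g (sg_F i x) * v x) = (LINT x:SG|\<mu>. 1/5 * g (sg_F i x) * v x)"
    by (simp only: set_integral_mult_right[symmetric] mult.assoc)
  finally show "sg_energy (u \<circ> sg_F i) v = - (LINT x:SG|\<mu>. 1/5 * g (sg_F i x) * v x)" .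
qed

lemma sg_laplacian_lincomb:
  assumes "sg_laplacian \<mu> u f" "sg_laplacian \<mu> v g"
  shows "sg_laplacian \<mu> (\<lambda>x. a * u x + b * v x) (\<lambda>x. a * f x + b * g x)"
  unfolding sg_laplacian_def
proof (intro conjI ballI impI)
  have u: "u \<in> sg_dom_energy" "continuous_on SG f" and v: "v \<in> sg_dom_energy" "continuous_on SG g"
    using assms by (auto simp: sg_laplacian_def)
  show "(\<lambda>x. a * u x + b * v x) \<in> sg_dom_energy"
    by (rule sg_dom_energy_lincomb[OF u(1) v(1)])
  show "continuous_on SG (\<lambda>x. a * f x + b * g x)"
    by (intro continuous_intros u v)
  fix w assume w: "w \<in> sg_dom_energy" "\<forall>x\<in>sg_V 0. w x = 0"
  have "(LINT x:SG|\<mu>. (a * f x + b * g x) * w x) = (LINT x:SG|\<mu>. a * (f x * w x) + b * (g x * w x))"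
    by (simp add: algebra_simps)
  also have "\<dots> = a * (LINT x:SG|\<mu>. f x * w x) + b * (LINT x:SG|\<mu>. g x * w x)"
    by (intro LINT_lincomb continuous_intros u v w sg_dom_energy_continuous)
  finally show "sg_energy (\<lambda>x. a * u x + b * v x) w = - (LINT x:SG|\<mu>. (a * f x + b * g x) * w x)"
    using assms w by (simp add: sg_energy_lincomb u v sg_laplacian_def)
qed

section \<open>Powers of the Laplacian on cells\<close>

lemma sg_laplacian_pow_lincomb:
  "sg_laplacian_pow \<mu> k u f \<Longrightarrow> sg_laplacian_pow \<mu> k v g \<Longrightarrow>
     sg_laplacian_pow \<mu> k (\<lambda>x. a * u x + b * v x) (\<lambda>x. a * f x + b * g x)"
proof (induction k arbitrary: u v)
  case (Suc k)
  then obtain u' v' where "sg_laplacian \<mu> u u'" "sg_laplacian_pow \<mu> k u' f"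
      "sg_laplacian \<mu> v v'" "sg_laplacian_pow \<mu> k v' g"
    by auto
  then show ?case
    using sg_laplacian_lincomb[of u u' v v' a b] Suc.IH[of u' v'] by auto
qed simp

lemma sg_laplacian_pow_comp_F:
  assumes "i < 3"
  shows "sg_laplacian_pow \<mu> k u f \<Longrightarrow>
    sg_laplacian_pow \<mu> k (u \<circ> sg_F i) (\<lambda>x. (1/5) ^ k * f (sg_F i x))"
proof (induction k arbitrary: u)
  case 0
  then show ?case
    using assms sg_F_in_SG by simp
next
  case (Suc k)
  then obtain g where g: "sg_laplacian \<mu> u g" "sg_laplacian_pow \<mu> k g f"
    by auto
  \<comment> \<open>A linear combination with second coefficient 0 serves as multiplication by
    1/5.\<close>
  have "sg_laplacian_pow \<mu> k (\<lambda>x. 1/5 * (g \<circ> sg_F i) x + 0 * (g \<circ> sg_F i) x)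
      (\<lambda>x. 1/5 * ((1/5) ^ k * f (sg_F i x)) + 0 * ((1/5) ^ k * f (sg_F i x)))"
    using Suc.IH[OF g(2)] by (intro sg_laplacian_pow_lincomb)
  then have "sg_laplacian_pow \<mu> k (\<lambda>x. 1/5 * g (sg_F i x)) (\<lambda>x. (1/5) ^ Suc k * f (sg_F i x))"
    by (simp add: mult.assoc)
  then show ?case
    unfolding sg_laplacian_pow.simps using sg_laplacian_comp_F[OF g(1) assms] by blast
qed

lemma sg_laplacian_pow_comp_Fw:
  "w \<in> sg_words r \<Longrightarrow> sg_laplacian_pow \<mu> k u f \<Longrightarrow>
    sg_laplacian_pow \<mu> k (u \<circ> sg_Fw w) (\<lambda>x. (1/5) ^ (k * r) * f (sg_Fw w x))"
proof (induction r arbitrary: w u f)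
  case (Suc r)
  then obtain i v where w: "w = i # v" "i < 3" "v \<in> sg_words r"
    by (auto simp: sg_words_Suc)
  show ?case
    using Suc.IH[OF w(3) sg_laplacian_pow_comp_F[OF w(2) Suc.prems(2)]]
    by (simp add: w o_assoc power_add mult.assoc mult.left_commute)
qed simp

lemma LINT_words:
  fixes f :: "real^2 \<Rightarrow> real"
  assumes "continuous_on SG f"
  shows "(LINT x:SG|\<mu>. f x) = (1/3) ^ r * (\<Sum>w\<in>sg_words r. LINT x:SG|\<mu>. f (sg_Fw w x))"
  using assms
proof (induction r arbitrary: f)
  case (Suc r)
  have "(LINT x:SG|\<mu>. f x) = 1/3 * (\<Sum>i<3. LINT x:SG|\<mu>. f (sg_F i x))"
    using LINT_self_similar[OF Suc.prems] by simp
  also have "(\<Sum>i<3. LINT x:SG|\<mu>. f (sg_F i x)) =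
      (\<Sum>i<3. (1/3) ^ r * (\<Sum>w\<in>sg_words r. LINT x:SG|\<mu>. f (sg_F i (sg_Fw w x))))"
    using continuous_on_sg_F[OF Suc.prems] by (intro sum.cong refl Suc.IH) auto
  finally show ?case
    by (simp add: sum_sg_words_Suc sum_distrib_left mult.assoc)
qed simp

end

subsection \<open>The Dirichlet problem for Poisson's equation\<close>

text \<open>Near \<open>t = 0\<close> a nonzero linear term would win over the quadratic one. This
  turns minimality into the Euler-Lagrange equation.\<close>

lemma quadratic_nonneg_imp_zero:
  fixes a c :: real
  assumes "0 \<le> a" "\<And>t. 0 \<le> t\<^sup>2 * a + 2 * t * c"
  shows "c = 0"
proof -
  \<comment> \<open>Dividing by \<open>a + 1\<close> rather than \<open>a\<close> also covers
    \<open>a = 0\<close>.\<close>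
  let ?t = "- c / (a + 1)"
  have "0 \<le> (?t\<^sup>2 * a + 2 * ?t * c) * (a + 1)\<^sup>2"
    using assms(2)[of ?t] by simp
  also have "\<dots> = (?t * (a + 1))\<^sup>2 * a + 2 * (?t * (a + 1)) * c * (a + 1)"
    by (simp add: power2_eq_square algebra_simps)
  also have "?t * (a + 1) = - c"
    using assms(1) by simp
  finally have "0 \<le> - (c\<^sup>2 * (a + 2))"
    by (simp add: power2_eq_square algebra_simps)
  then have "c\<^sup>2 * (a + 2) \<le> 0"
    by simp
  then show "c = 0"
    using assms(1) by (simp add: mult_le_0_iff)
qed

definition sg_dom_energy_0 :: "(real^2 \<Rightarrow> real) set" where
  "sg_dom_energy_0 = {v \<in> sg_dom_energy. \<forall>x\<in>sg_V 0. v x = 0}"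

lemma sg_dom_energy_0_lincomb:
  "u \<in> sg_dom_energy_0 \<Longrightarrow> v \<in> sg_dom_energy_0 \<Longrightarrow> (\<lambda>x. a * u x + b * v x) \<in> sg_dom_energy_0"
  by (simp add: sg_dom_energy_0_def sg_dom_energy_lincomb)

lemma zero_in_sg_dom_energy_0: "(\<lambda>_. 0) \<in> sg_dom_energy_0"
  by (simp add: sg_dom_energy_0_def sg_dom_energy_const)

context sg_measure
begin

text \<open>The weak solution is the minimiser of the functional \<open>J\<close> below; a minimising sequence is
  Cauchy in energy by the parallelogram law, hence uniformly Cauchy.\<close>

lemma poisson_solution:
  assumes g: "continuous_on SG g" and B: "\<And>x. x \<in> SG \<Longrightarrow> \<bar>g x\<bar> \<le> B"
  obtains u where "sg_laplacian \<mu> u g" "\<And>x. x \<in> SG \<Longrightarrow> \<bar>u x\<bar> \<le> sg_osc_const\<^sup>2 * B"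
proof -
  define K where "K = sg_osc_const"
  define E where "E v = sg_energy v v" for v
  define l where "l v = (LINT x:SG|\<mu>. g x * v x)" for v
  \<comment> \<open>With the factor 2 the Euler-Lagrange equation is
    \<open>sg_energy u w + l w = 0\<close>, the weak Poisson equation.\<close>
  define J where "J v = E v + 2 * l v" for v
  let ?D = sg_dom_energy_0
  have K: "0 < K"
    unfolding K_def by (rule sg_osc_const_pos)
  have B0: "0 \<le> B"
    using B[of "sg_q 0"] sg_q_in_SG[of 0] by force
  have dom: "v \<in> sg_dom_energy" if "v \<in> ?D" for v
    using that by (simp add: sg_dom_energy_0_def)
  have cont: "continuous_on SG v" if "v \<in> ?D" for v
    using dom[OF that] by (rule sg_dom_energy_continuous)
  have E_nonneg: "0 \<le> E v" if "v \<in> ?D" for v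
    unfolding E_def by (rule sg_energy_nonneg[OF dom[OF that]])
  have osc: "\<bar>v x\<bar> \<le> K * sqrt (E v)" if "v \<in> ?D" "x \<in> SG" for v x
    using sg_osc_bound[of v x] that by (simp add: sg_dom_energy_0_def K_def E_def)
  have l_lin: "l (\<lambda>x. a * u x + b * v x) = a * l u + b * l v"
    if "continuous_on SG u" "continuous_on SG v" for a b u v
  proof -
    have "l (\<lambda>x. a * u x + b * v x) = (LINT x:SG|\<mu>. a * (g x * u x) + b * (g x * v x))"
      unfolding l_def by (simp add: algebra_simps)
    then show ?thesis
      unfolding l_def using that g by (subst (asm) LINT_lincomb) (auto intro!: continuous_intros)
  qed
  have l_bound: "\<bar>l v\<bar> \<le> B * M" if "continuous_on SG v" "\<And>x. x \<in> SG \<Longrightarrow> \<bar>v x\<bar> \<le> M" for v M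
    unfolding l_def using that B B0 g
    by (intro LINT_bound continuous_intros) (auto simp: abs_mult intro!: mult_mono)
  have l_energy: "\<bar>l v\<bar> \<le> B * (K * sqrt (E v))" if "v \<in> ?D" for v
    using that osc cont by (intro l_bound) auto
  have J_lower: "- (B * K)\<^sup>2 \<le> J v" if "v \<in> ?D" for v
  proof -
    have "0 \<le> (sqrt (E v) - B * K)\<^sup>2"
      by simp
    then have "- (B * K)\<^sup>2 \<le> (sqrt (E v))\<^sup>2 - 2 * (B * (K * sqrt (E v)))"
      by (simp add: power2_diff algebra_simps)
    then show ?thesis
      using l_energy[OF that] E_nonneg[OF that] by (simp add: J_def)
  qed
  define d where "d = (INF v\<in>?D. J v)"
  have bdd: "bdd_below (J ` ?D)"
    using J_lower by (intro bdd_belowI2)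
  have d: "d \<le> J v" if "v \<in> ?D" for v
    unfolding d_def using bdd that by (rule cINF_lower)
  have "\<exists>v\<in>?D. J v < d + inverse (real (Suc n))" for n
    using cINF_less_iff[OF _ bdd, of "d + inverse (real (Suc n))"] zero_in_sg_dom_energy_0
    unfolding d_def[symmetric] by auto
  then obtain v where v: "\<And>n. v n \<in> ?D" "\<And>n. J (v n) < d + inverse (real (Suc n))"
    by metis
  have parallelogram: "E (\<lambda>x. 1 * v j x + (-1) * v k x) \<le>
      2 * (inverse (real (Suc j)) + inverse (real (Suc k)))" for j k
  proof -
    \<comment> \<open>The parallelogram law as linear arithmetic: \<open>c\<close> is the mixed
      energy, and the midpoint, being admissible, has \<open>J\<close> at least
      \<open>d\<close>.\<close>
    have arith: "e \<le> 2 * (s + t)"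
      if "m = (a + 2 * c + b) / 4" "lm = (la + lb) / 2" "d \<le> m + 2 * lm" "e = a - 2 * c + b"
        "a + 2 * la < d + s" "b + 2 * lb < d + t" for a b c e m la lb lm s t :: real
      using that by (simp add: field_simps)
    let ?m = "\<lambda>x. (1/2) * v j x + (1/2) * v k x"
    have "E ?m = (E (v j) + 2 * sg_energy (v j) (v k) + E (v k)) / 4"
      unfolding E_def by (subst sg_energy_square) (simp_all add: dom v power2_eq_square field_simps)
    moreover have "l ?m = (l (v j) + l (v k)) / 2"
      by (subst l_lin) (simp_all add: cont v)
    moreover have "d \<le> J ?m"
      by (intro d sg_dom_energy_0_lincomb v)
    moreover have "E (\<lambda>x. 1 * v j x + (-1) * v k x) =
        E (v j) - 2 * sg_energy (v j) (v k) + E (v k)"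
      unfolding E_def by (subst sg_energy_square) (simp_all add: dom v)
    ultimately show ?thesis
      using v(2)[of j] v(2)[of k] unfolding J_def by (rule arith)
  qed
  have "uniformly_Cauchy_on SG v"
    unfolding uniformly_Cauchy_on_def
  proof (intro allI impI)
    fix e :: real assume "0 < e"
    then obtain N where N: "inverse (real (Suc N)) < (e / K)\<^sup>2 / 4"
      using reals_Archimedean[of "(e / K)\<^sup>2 / 4"] K by auto
    have "dist (v j x) (v k x) < e" if "x \<in> SG" "j \<ge> N" "k \<ge> N" for x j k
    proof -
      note parallelogram[of j k]
      also have "2 * (inverse (real (Suc j)) + inverse (real (Suc k))) \<le>
          2 * (inverse (real (Suc N)) + inverse (real (Suc N)))"
        using that by (intro mult_left_mono add_mono le_imp_inverse_le) auto
      also have "\<dots> < (e / K)\<^sup>2"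
        using N by simp
      finally have "E (\<lambda>x. 1 * v j x + (-1) * v k x) < (e / K)\<^sup>2" .
      then have "sqrt (E (\<lambda>x. 1 * v j x + (-1) * v k x)) < e / K"
        using \<open>0 < e\<close> K by (intro real_less_lsqrt) auto
      then have "K * sqrt (E (\<lambda>x. 1 * v j x + (-1) * v k x)) < e"
        using K by (simp add: field_simps)
      then show ?thesis
        using osc[OF sg_dom_energy_0_lincomb[OF v(1) v(1)] \<open>x \<in> SG\<close>, of 1 j "-1" k]
        by (simp add: dist_real_def)
    qed
    then show "\<exists>M. \<forall>x\<in>SG. \<forall>m\<ge>M. \<forall>n\<ge>M. dist (v m x) (v n x) < e"
      by blast
  qed
  then have "uniformly_convergent_on SG v"
    by (rule Cauchy_uniformly_convergent)
  then obtain u where u: "uniform_limit SG v u sequentially"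
    by (auto simp: uniformly_convergent_on_def)
  have u_cont: "continuous_on SG u"
    using u cont v(1) by (intro uniform_limit_theorem[OF _ u]) auto
  have u_lim: "(\<lambda>n. v n x) \<longlonglongrightarrow> u x" if "x \<in> SG" for x
    using u that by (rule tendsto_uniform_limitI)
  have l_lim: "(\<lambda>n. l (v n)) \<longlonglongrightarrow> l u"
  proof (rule tendstoI)
    fix e :: real assume "0 < e"
    then have "0 < e / (B + 1)"
      using B0 by simp
    with u have "\<forall>\<^sub>F n in sequentially. \<forall>x\<in>SG. dist (v n x) (u x) < e / (B + 1)"
      by (rule uniform_limitD)
    then show "\<forall>\<^sub>F n in sequentially. dist (l (v n)) (l u) < e"
    proof eventually_elim
      case (elim n)
      have "l (\<lambda>x. 1 * v n x + (-1) * u x) = l (v n) - l u"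
        by (subst l_lin) (simp_all add: cont v u_cont)
      moreover have "\<bar>l (\<lambda>x. 1 * v n x + (-1) * u x)\<bar> \<le> B * (e / (B + 1))"
        using elim by (intro l_bound continuous_intros cont v u_cont)
          (auto simp: dist_real_def less_imp_le)
      moreover have "B * (e / (B + 1)) < e"
        using B0 \<open>0 < e\<close> by (simp add: field_simps)
      ultimately show ?case
        by (simp add: dist_real_def)
    qed
  qed
  \<comment> \<open>Each level energy of \<open>v n\<close> is at most
    \<open>J (v n) - 2 * l (v n)\<close>. Letting \<open>n\<close> tend to infinity at fixed
    \<open>r\<close> gives a bound independent of \<open>r\<close>, hence finite energy of
    \<open>u\<close>.\<close>
  have level: "sg_energy_level r u u \<le> d - 2 * l u" for r
  proof (rule LIMSEQ_le)
    show "(\<lambda>n. sg_energy_level r (v n) (v n)) \<longlonglongrightarrow> sg_energy_level r u u"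
      by (intro sg_energy_level_tendsto u_lim)
    have "(\<lambda>n. d + inverse (real (Suc n)) - 2 * l (v n)) \<longlonglongrightarrow> d + 0 - 2 * l u"
      by (intro tendsto_intros LIMSEQ_inverse_real_of_nat l_lim)
    then show "(\<lambda>n. d + inverse (real (Suc n)) - 2 * l (v n)) \<longlonglongrightarrow> d - 2 * l u"
      by simp
    have "sg_energy_level r (v n) (v n) \<le> d + inverse (real (Suc n)) - 2 * l (v n)" for n
      using sg_energy_level_le[OF dom[OF v(1)], of r n] v(2)[of n] by (simp add: J_def E_def)
    then show "\<exists>N. \<forall>n\<ge>N. sg_energy_level r (v n) (v n) \<le> d + inverse (real (Suc n)) - 2 * l (v n)"
      by blast
  qed
  have u_dom: "u \<in> sg_dom_energy"
    by (rule sg_dom_energyI[OF u_cont level])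
  have "u x = 0" if "x \<in> sg_V 0" for x
  proof (rule LIMSEQ_unique)
    show "(\<lambda>n. v n x) \<longlonglongrightarrow> u x"
      using that sg_V_subset_SG u_lim by blast
    show "(\<lambda>n. v n x) \<longlonglongrightarrow> 0"
      using v(1) that by (simp add: sg_dom_energy_0_def)
  qed
  then have u_D: "u \<in> ?D"
    using u_dom by (simp add: sg_dom_energy_0_def)
  have J_u: "J u \<le> d"
    using sg_energy_le[OF level u_dom] by (simp add: J_def E_def)
  \<comment> \<open>First variation: \<open>u + t w\<close> is admissible for every real
    \<open>t\<close>, so its \<open>J\<close> cannot fall below \<open>d\<close>.\<close>
  have weak: "sg_energy u w + l w = 0" if w: "w \<in> ?D" for w
  proof (rule quadratic_nonneg_imp_zero)
    show "0 \<le> E w"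
      by (rule E_nonneg[OF w])
    fix t
    have "E (\<lambda>x. 1 * u x + t * w x) = E u + 2 * t * sg_energy u w + t\<^sup>2 * E w"
      unfolding E_def by (subst sg_energy_square) (simp_all add: dom w u_D)
    moreover have "l (\<lambda>x. 1 * u x + t * w x) = l u + t * l w"
      by (subst l_lin) (simp_all add: cont w u_D)
    moreover have "d \<le> J (\<lambda>x. 1 * u x + t * w x)"
      by (intro d sg_dom_energy_0_lincomb w u_D)
    ultimately show "0 \<le> t\<^sup>2 * E w + 2 * t * (sg_energy u w + l w)"
      using J_u by (simp add: J_def algebra_simps)
  qed
  show thesis
  proof
    show "sg_laplacian \<mu> u g"
      unfolding sg_laplacian_def
    proof (intro conjI ballI impI u_dom g)
      fix w assume "w \<in> sg_dom_energy" "\<forall>x\<in>sg_V 0. w x = 0"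
      then show "sg_energy u w = - (LINT x:SG|\<mu>. g x * w x)"
        using weak[of w] by (simp add: sg_dom_energy_0_def l_def)
    qed
    fix x assume x: "x \<in> SG"
    \<comment> \<open>Testing with \<open>u\<close> itself gives \<open>E u = - l u\<close>, and
      \<open>l_energy\<close> bounds this by a multiple of \<open>sqrt (E u)\<close>. One root
      cancels unless it is zero; \<open>osc\<close> then contributes the second factor
      \<open>K\<close>.\<close>
    have "sqrt (E u) * sqrt (E u) \<le> sqrt (E u) * (B * K)"
      using weak[OF u_D] l_energy[OF u_D] E_nonneg[OF u_D] by (simp add: E_def mult_ac)
    then have "sqrt (E u) \<le> B * K"
    proof (cases "E u = 0")
      case False
      then have "0 < sqrt (E u)"
        using E_nonneg[OF u_D] by simp
      with \<open>sqrt (E u) * sqrt (E u) \<le> sqrt (E u) * (B * K)\<close> show ?thesis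
        by (rule mult_left_le_imp_le)
    qed (use B0 K in simp)
    then have "K * sqrt (E u) \<le> K * (B * K)"
      using K by simp
    then show "\<bar>u x\<bar> \<le> sg_osc_const\<^sup>2 * B"
      using osc[OF u_D x] by (simp add: K_def power2_eq_square mult_ac)
  qed
qed

text \<open>Each inversion of the Laplacian costs a factor \<open>K\<close> squared, with
  \<open>K\<close> the oscillation constant, and returns a continuous function that can be the next
  right-hand side.\<close>

lemma iterated_poisson_solution:
  assumes "continuous_on SG g" "\<And>x. x \<in> SG \<Longrightarrow> \<bar>g x\<bar> \<le> B"
  shows "\<exists>u. sg_laplacian_pow \<mu> k u g \<and> continuous_on SG u \<and>
    (\<forall>x\<in>SG. \<bar>u x\<bar> \<le> sg_osc_const ^ (2 * k) * B)"
proof (induction k)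
  case 0
  then show ?case
    using assms by auto
next
  case (Suc k)
  then obtain p where p: "sg_laplacian_pow \<mu> k p g" "continuous_on SG p"
      "\<And>x. x \<in> SG \<Longrightarrow> \<bar>p x\<bar> \<le> sg_osc_const ^ (2 * k) * B"
    by blast
  obtain u where u: "sg_laplacian \<mu> u p"
      "\<And>x. x \<in> SG \<Longrightarrow> \<bar>u x\<bar> \<le> sg_osc_const\<^sup>2 * (sg_osc_const ^ (2 * k) * B)"
    using poisson_solution[OF p(2,3)] by blast
  then have "continuous_on SG u"
    by (auto simp: sg_laplacian_def intro: sg_dom_energy_continuous)
  then show ?case
    using u p(1) by (intro exI[of _ u]) (auto simp: power2_eq_square mult.assoc)
qed

end

subsection \<open>Quadrature\<close>

lemma sg_node_in_SG: "sg_node n i \<in> SG"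
proof -
  have "(sg_F 0 ^^ k) (sg_q j) \<in> SG" if "j < 3" for j k
    using that by (induction k) (auto intro: sg_q_in_SG sg_F_in_SG)
  then show ?thesis
    by (simp add: sg_node_def)
qed

lemma sg_quad_lincomb:
  "sg_quad \<omega> n (\<lambda>x. a * f x + b * g x) = a * sg_quad \<omega> n f + b * sg_quad \<omega> n g"
  by (simp add: sg_quad_def sum.distrib sum_distrib_left distrib_left mult.left_commute)

lemma sg_quad_bound:
  assumes "\<And>x. x \<in> SG \<Longrightarrow> \<bar>f x\<bar> \<le> B"
  shows "\<bar>sg_quad \<omega> n f\<bar> \<le> (\<Sum>i = 1..3 * n + 3. \<bar>\<omega> i\<bar>) * B"
proof -
  have "\<bar>sg_quad \<omega> n f\<bar> \<le> (\<Sum>i = 1..3 * n + 3. \<bar>\<omega> i * f (sg_node n i)\<bar>)"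
    unfolding sg_quad_def by (rule sum_abs)
  also have "\<dots> \<le> (\<Sum>i = 1..3 * n + 3. \<bar>\<omega> i\<bar> * B)"
    by (intro sum_mono) (auto simp: abs_mult intro!: mult_left_mono assms sg_node_in_SG)
  finally show ?thesis
    by (simp add: sum_distrib_right)
qed

text \<open>In the constant, the sum of the absolute weights accounts for the rule applied to
  \<open>p\<close>, and the added 1 for the integral of \<open>p\<close> against a probability
  measure.\<close>

lemma (in sg_measure) quadrature_error:
  assumes exact: "\<And>h. h \<in> sg_H \<mu> n \<Longrightarrow> sg_quad \<omega> n h = (LINT x:SG|\<mu>. h x)"
    and u: "sg_laplacian_pow \<mu> (n + 1) u g" "continuous_on SG g" "\<And>x. x \<in> SG \<Longrightarrow> \<bar>g x\<bar> \<le> B"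
  shows "\<bar>sg_quad \<omega> n u - (LINT x:SG|\<mu>. u x)\<bar> \<le>
    ((\<Sum>i = 1..3 * n + 3. \<bar>\<omega> i\<bar>) + 1) * sg_osc_const ^ (2 * (n + 1)) * B"
proof -
  let ?W = "\<Sum>i = 1..3 * n + 3. \<bar>\<omega> i\<bar>" and ?P = "sg_osc_const ^ (2 * (n + 1)) * B"
  obtain p where p: "sg_laplacian_pow \<mu> (n + 1) p g" "continuous_on SG p"
      "\<And>x. x \<in> SG \<Longrightarrow> \<bar>p x\<bar> \<le> ?P"
    using iterated_poisson_solution[OF u(2,3), of "n + 1"] by blast
  have u_cont: "continuous_on SG u"
    using u(1) by (auto simp: sg_laplacian_def intro: sg_dom_energy_continuous)
  let ?h = "\<lambda>x. 1 * u x + (-1) * p x"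
  have "sg_laplacian_pow \<mu> (n + 1) ?h (\<lambda>x. 1 * g x + (-1) * g x)"
    by (rule sg_laplacian_pow_lincomb[OF u(1) p(1)])
  then have "?h \<in> sg_H \<mu> n"
    by (simp add: sg_H_def)
  then have "sg_quad \<omega> n ?h = (LINT x:SG|\<mu>. ?h x)"
    by (rule exact)
  then have "sg_quad \<omega> n u - (LINT x:SG|\<mu>. u x) = sg_quad \<omega> n p - (LINT x:SG|\<mu>. p x)"
    unfolding sg_quad_lincomb LINT_lincomb[OF u_cont p(2)] by simp
  moreover have "\<bar>sg_quad \<omega> n p\<bar> \<le> ?W * ?P"
    by (rule sg_quad_bound[OF p(3)])
  moreover have "\<bar>LINT x:SG|\<mu>. p x\<bar> \<le> ?P"
    by (rule LINT_bound[OF p(2,3)])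
  ultimately show ?thesis
    unfolding mult.assoc distrib_right by linarith
qed

section \<open>The composite rule\<close>

lemma continuous_on_sg_Fw:
  assumes "continuous_on SG f" "w \<in> sg_words r"
  shows "continuous_on SG (\<lambda>x. f (sg_Fw w x))"
proof (rule continuous_on_compose2[OF assms(1)])
  show "continuous_on SG (sg_Fw w)"
    by (induction w) (auto simp: id_def o_def intro!: continuous_intros)
  show "sg_Fw w ` SG \<subseteq> SG"
    using assms(2) sg_Fw_in_SG by blast
qed

lemma sg_laplacian_pow_continuous:
  assumes "sg_laplacian_pow \<mu> (n + 1) f g"
  shows "continuous_on SG f" "continuous_on SG g"
proof -
  show "continuous_on SG f"
    using assms by (auto simp: sg_laplacian_def intro: sg_dom_energy_continuous)
  show "continuous_on SG g"
    using assms
  proof (induction n arbitrary: f)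
    \<comment> \<open>\<open>g\<close> is only required to agree on \<open>SG\<close> with a
      Laplacian of \<open>f\<close>; continuity is transferred along this agreement.\<close>
    case 0
    then obtain h where "continuous_on SG h" "\<forall>x\<in>SG. h x = g x"
      by (auto simp: sg_laplacian_def)
    then show ?case
      by (simp cong: continuous_on_cong)
  qed auto
qed

theorem theorem4p1:
  fixes n :: nat and \<omega> :: "nat \<Rightarrow> real" and \<mu> :: "(real^2) measure"
  assumes "is_sg_measure \<mu>"
    and "\<And>h. h \<in> sg_H \<mu> n \<Longrightarrow> sg_quad \<omega> n h = (LINT x:SG|\<mu>. h x)"
  shows "\<exists>c1 :: real. \<forall>m\<ge>n. \<forall>f g. sg_laplacian_pow \<mu> (n + 1) f g \<longrightarrow>
           \<bar>sg_composite_quad \<omega> n m f - (LINT x:SG|\<mu>. f x)\<bar>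
             \<le> c1 * (1/5) ^ ((n + 1) * m) * sg_sup_norm g"
proof -
  interpret sg_measure \<mu>
    by standard (rule assms(1))
  define C where "C = ((\<Sum>i = 1..3 * n + 3. \<bar>\<omega> i\<bar>) + 1) * sg_osc_const ^ (2 * (n + 1))"
  show ?thesis
  proof (intro exI allI impI)
    fix m f g assume m: "n \<le> m" and f: "sg_laplacian_pow \<mu> (n + 1) f g"
    define r where "r = m - n"
    note cont = sg_laplacian_pow_continuous[OF f]
    \<comment> \<open>\<open>sg_sup_norm\<close> is a real supremum and dominates the values only
      once they are known to be bounded.\<close>
    have "bdd_above ((\<lambda>x. \<bar>g x\<bar>) ` SG)"
      using cont(2) by (intro bounded_imp_bdd_above compact_imp_bounded compact_continuous_image
          continuous_intros compact_SG)
    then have g: "\<bar>g x\<bar> \<le> sg_sup_norm g" if "x \<in> SG" for x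
      unfolding sg_sup_norm_def using that by (intro cSUP_upper)
    have cell: "\<bar>sg_quad \<omega> n (f \<circ> sg_Fw w) - (LINT x:SG|\<mu>. f (sg_Fw w x))\<bar>
        \<le> C * ((1/5) ^ ((n + 1) * r) * sg_sup_norm g)" if w: "w \<in> sg_words r" for w
    proof -
      have "\<bar>(1/5) ^ ((n + 1) * r) * g (sg_Fw w x)\<bar> \<le> (1/5) ^ ((n + 1) * r) * sg_sup_norm g"
        if "x \<in> SG" for x
        using g[OF sg_Fw_in_SG[OF w that]] by (simp add: abs_mult)
      then show ?thesis
        using quadrature_error[OF assms(2) sg_laplacian_pow_comp_Fw[OF w f]]
          continuous_on_sg_Fw[OF cont(2) w]
        unfolding C_def by (simp add: o_def continuous_on_mult_left)
    qed
    have "sg_composite_quad \<omega> n m f - (LINT x:SG|\<mu>. f x) = (1/3) ^ r *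
        (\<Sum>w\<in>sg_words r. sg_quad \<omega> n (f \<circ> sg_Fw w) - (LINT x:SG|\<mu>. f (sg_Fw w x)))"
      unfolding sg_composite_quad_def LINT_words[OF cont(1), of r] r_def[symmetric]
      by (simp add: sum_subtractf right_diff_distrib)
    also have "\<bar>\<dots>\<bar> \<le> (1/3) ^ r * (\<Sum>w\<in>sg_words r. C * ((1/5) ^ ((n + 1) * r) * sg_sup_norm g))"
      unfolding abs_mult
      by (intro mult_mono order_trans[OF sum_abs] sum_mono cell) auto
    \<comment> \<open>The \<open>3 ^ r\<close> equal terms cancel the weight
      \<open>(1/3) ^ r\<close>.\<close>
    also have "\<dots> = C * ((1/5) ^ ((n + 1) * r) * sg_sup_norm g)"
      by (simp add: card_sg_words power_one_over)
    \<comment> \<open>The cells have level \<open>r = m - n\<close>, while the rate is stated in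
      \<open>m\<close>. The discrepancy \<open>5 ^ ((n + 1) * n)\<close> depends on \<open>n\<close>
      alone and joins the constant.\<close>
    also have "\<dots> = C * 5 ^ ((n + 1) * n) * (1/5) ^ ((n + 1) * m) * sg_sup_norm g"
    proof -
      have "(n + 1) * m = (n + 1) * r + (n + 1) * n"
        unfolding r_def distrib_left[symmetric] using m by simp
      then show ?thesis
        by (simp only: power_add) (simp add: power_one_over)
    qed
    finally show "\<bar>sg_composite_quad \<omega> n m f - (LINT x:SG|\<mu>. f x)\<bar>
        \<le> C * 5 ^ ((n + 1) * n) * (1/5) ^ ((n + 1) * m) * sg_sup_norm g" .
  qed
qed

end
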